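(* For a positive integer $n$, let $M(K_{n+1})$ denote the cycle matroid of the complete graph $K_{n+1}$ on vertex set $\{1,\dots,n+1\}$, with ground set $E$ the edge set of $K_{n+1}$. The number of (single-element) extensions of $M(K_{n+1})$ is $2^{\binom{n}{\lfloor n/2\rfloor}(1+o(1))}$, where $o(1)$ denotes a function of $n$ tending to $0$ as $n\to\infty$.
   Context: A matroid $N$ is an extension of a matroid $M$ if $N\backslash e = M$ for some element $e$ of $N$ that is not a coloop of $N$. Extensions of $M$ are counted as distinct matroids $N$ on the ground set $E\cup\{e\}$ for a fixed new element $e\notin E$. *)

theory Defs
  imports Complex_Main
begin

section \<open>Finite matroids\<close>

record 'a set_system =
  ground :: "'a set"
  indep :: "'a set set"

definition matroid :: "'a set_system \<Rightarrow> bool" where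
  "matroid M \<longleftrightarrow>
     finite (ground M) \<and>
     indep M \<subseteq> Pow (ground M) \<and>
     {} \<in> indep M \<and>
     (\<forall>X Y. Y \<in> indep M \<longrightarrow> X \<subseteq> Y \<longrightarrow> X \<in> indep M) \<and>
     (\<forall>X Y. X \<in> indep M \<longrightarrow> Y \<in> indep M \<longrightarrow> card X < card Y \<longrightarrow>
        (\<exists>y\<in>Y - X. insert y X \<in> indep M))"

definition basis :: "'a set_system \<Rightarrow> 'a set \<Rightarrow> bool" where
  "basis M B \<longleftrightarrow> B \<in> indep M \<and> (\<forall>X\<in>indep M. B \<subseteq> X \<longrightarrow> X = B)"

definition coloop :: "'a set_system \<Rightarrow> 'a \<Rightarrow> bool" where
  "coloop M x \<longleftrightarrow> x \<in> ground M \<and> (\<forall>B. basis M B \<longrightarrow> x \<in> B)"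

definition deletion :: "'a set_system \<Rightarrow> 'a \<Rightarrow> 'a set_system" where
  "deletion M x = \<lparr>ground = ground M - {x}, indep = {X \<in> indep M. x \<notin> X}\<rparr>"


section \<open>Single-element extensions\<close>

definition is_extension :: "'a set_system \<Rightarrow> 'a set_system \<Rightarrow> bool" where
  "is_extension N M \<longleftrightarrow>
     matroid N \<and> (\<exists>x\<in>ground N. \<not> coloop N x \<and> deletion N x = M)"

text \<open>Extensions are labelled: they are counted as distinct matroids on the ground set of \<open>M\<close>
  enlarged by the fixed element \<open>e\<close>, not up to isomorphism. The new element may be a loop or
  parallel to an old one.\<close>

definition extensions :: "'a set_system \<Rightarrow> 'a \<Rightarrow> 'a set_system set" where
  "extensions M e = {N. is_extension N M \<and> ground N = insert e (ground M)}"

text \<open>Hence the cardinality of \<open>extensions M e\<close> is never that of an infinite set.\<close>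

lemma finite_extensions: "finite (extensions M e)"
proof (cases "finite (ground M)")
  case True
  let ?G = "insert e (ground M)"
  have "extensions M e \<subseteq> (\<lambda>I. \<lparr>ground = ?G, indep = I\<rparr>) ` Pow (Pow ?G)"
  proof
    fix N assume "N \<in> extensions M e"
    then have *: "ground N = ?G" "matroid N"
      unfolding extensions_def is_extension_def by blast+
    then have "indep N \<subseteq> Pow ?G"
      unfolding matroid_def by (elim conjE) simp
    with *(1) show "N \<in> (\<lambda>I. \<lparr>ground = ?G, indep = I\<rparr>) ` Pow (Pow ?G)"
      by (intro image_eqI[of _ _ "indep N"]) auto
  qed
  with True show ?thesis
    by (meson finite_Pow_iff finite_imageI finite_insert finite_subset)
next
  case False
  have "N \<notin> extensions M e" for N
  proof
    assume "N \<in> extensions M e"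
    then have "ground N = insert e (ground M)" and "matroid N"
      unfolding extensions_def is_extension_def by blast+
    moreover from \<open>matroid N\<close> have "finite (ground N)"
      unfolding matroid_def by (rule conjunct1)
    ultimately show False using False by simp
  qed
  then have "extensions M e = {}" by blast
  then show ?thesis by simp
qed


section \<open>Cycle matroids of simple graphs\<close>

text \<open>A simple graph is given by its edges, which are two-element sets of vertices. A cycle is
  identified with its edge set; \<open>cycle_edges [v\<^sub>0, \<dots>, v\<^sub>k]\<close> includes the closing edge from
  \<open>v\<^sub>k\<close> to \<open>v\<^sub>0\<close>.\<close>

definition cycle_edges :: "'v list \<Rightarrow> 'v set set" where
  "cycle_edges vs = (\<lambda>i. {vs ! i, vs ! (Suc i mod length vs)}) ` {..<length vs}"

definition is_cycle :: "'v set set \<Rightarrow> bool" where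
  "is_cycle C \<longleftrightarrow> (\<exists>vs. distinct vs \<and> length vs \<ge> 3 \<and> C = cycle_edges vs)"

definition cycle_matroid :: "'v set set \<Rightarrow> 'v set set_system" where
  "cycle_matroid E =
     \<lparr>ground = E, indep = {F. F \<subseteq> E \<and> \<not> (\<exists>C. is_cycle C \<and> C \<subseteq> F)}\<rparr>"

definition complete_graph_edges :: "nat \<Rightarrow> nat set set" where
  "complete_graph_edges m = {{u, v} | u v. u \<in> {1..m} \<and> v \<in> {1..m} \<and> u \<noteq> v}"

end

theory Submission
  imports Defs "HOL-Real_Asymp.Real_Asymp"
begin

text \<open>A hyperplane of \<open>M(K\<^sub>n\<^sub>+\<^sub>1)\<close> splits the vertices into two parts, so hyperplanes correspond to the
  nonempty \<open>A \<subseteq> {1..n}\<close> (the part avoiding \<open>n + 1\<close>). An extension is determined by the set \<open>\<S>\<close> of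
  hyperplanes that span the new element. Since each flat of corank two lies on exactly the three
  hyperplanes \<open>A\<close>, \<open>B\<close>, \<open>A \<union> B\<close> for some disjoint \<open>A\<close> and \<open>B\<close>, the family \<open>\<S>\<close> is closed under disjoint unions
  and proper differences. Such a family is determined by its minimal members, so there are at most
  as many extensions as antichains in the Boolean lattice, and a branching argument bounds the
  number of those. Conversely, any intersecting antichain is the set of spanning hyperplanes of an
  extension; subfamilies of the \<open>(\<lfloor>n/2\<rfloor> + 1)\<close>-subsets give the lower bound.\<close>

text \<open>Write N = (n choose n div 2). The upper bound needs leading constant 1 in the exponent,
  yet the 2^n subsets that the branching runs through outnumber N by a factor of order sqrt n. What
  helps is that any family noticeably larger than N contains a set comparable to many others. Two
  parameters have to be balanced: a degree d and a cost \<epsilon> per subset. d/n must tend to 0 so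
  that the part left without branching has size close to N; \<epsilon> sqrt n must tend to 0 so that
  branching costs o(N) in the exponent; and \<epsilon> (1 + \<epsilon>)^d >= 1 is what makes the
  branching recurrence close. For the lower bound, an intersecting antichain contains at most one of
  A, B and A \<union> B when A and B are disjoint and nonempty, so the rule that two of them force
  the third holds vacuously. The layer above the middle is taken because sets of size n div 2 may be
  disjoint.\<close>

section \<open>Counting antichains in the Boolean lattice\<close>

text \<open>Branch on a vertex \<open>v\<close> of degree at least \<open>d\<close>: the independent sets avoiding \<open>v\<close> live in \<open>B - {v}\<close>, those
  containing \<open>v\<close> lose all neighbours of \<open>v\<close> as well.\<close>

lemma card_independent_sets_le:
  fixes adj :: "'a \<Rightarrow> 'a \<Rightarrow> bool" and \<epsilon> :: real
  assumes irrefl: "\<And>x. \<not> adj x x"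
    and dense: "\<And>B. B \<subseteq> V \<Longrightarrow> m < card B \<Longrightarrow> \<exists>v\<in>B. d \<le> card {w\<in>B. adj v w}"
    and \<epsilon>: "0 \<le> \<epsilon>" "1 \<le> \<epsilon> * (1 + \<epsilon>) ^ d"
    and "finite B" "B \<subseteq> V"
  shows "real (card {I. I \<subseteq> B \<and> (\<forall>x\<in>I. \<forall>y\<in>I. \<not> adj x y)}) \<le> 2 ^ m * (1 + \<epsilon>) ^ card B"
  using \<open>finite B\<close> \<open>B \<subseteq> V\<close>
proof (induction B rule: finite_psubset_induct)
  case (psubset B)
  define ind where "ind = (\<lambda>B. {I. I \<subseteq> B \<and> (\<forall>x\<in>I. \<forall>y\<in>I. \<not> adj x y)})"
  have fin: "finite (ind C)" if "finite C" for C
    using that by (auto simp: ind_def)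
  show ?case
  proof (cases "card B \<le> m")
    case True
    have "card (ind B) \<le> 2 ^ card B"
      using psubset.hyps card_mono[of "Pow B" "ind B"] by (auto simp: card_Pow ind_def)
    also have "\<dots> \<le> 2 ^ m" using True by simp
    finally have "real (card (ind B)) \<le> 2 ^ m"
      by (metis of_nat_le_iff of_nat_numeral of_nat_power)
    also have "\<dots> \<le> 2 ^ m * (1 + \<epsilon>) ^ card B"
      using \<epsilon>(1) by (simp add: mult_le_cancel_left1 one_le_power)
    finally show ?thesis by (simp add: ind_def)
  next
    case False
    then obtain v where v: "v \<in> B" "d \<le> card {w\<in>B. adj v w}"
      using dense[OF psubset.prems] by auto
    define K where "K = {w\<in>B. adj v w}"
    define C where "C = B - {v} - K"
    have vK: "v \<notin> K" and KB: "K \<subseteq> B - {v}" using irrefl by (auto simp: K_def)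
    have cB: "card (B - {v}) = card B - 1" "card B > 0"
      using v psubset.hyps by (auto simp: card_gt_0_iff)
    have cC: "card C + d \<le> card B - 1"
    proof -
      have "card (B - {v}) = card C + card K"
        using KB psubset.hyps unfolding C_def
        by (metis card_Diff_subset card_mono diff_add finite_Diff finite_subset)
      then show ?thesis using v(2) cB(1) by (simp add: K_def)
    qed
    have "ind B \<subseteq> ind (B - {v}) \<union> insert v ` ind C"
    proof
      fix I assume I: "I \<in> ind B"
      show "I \<in> ind (B - {v}) \<union> insert v ` ind C"
      proof (cases "v \<in> I")
        case True
        then have "I = insert v (I - {v})" "I - {v} \<in> ind C"
          using I by (auto simp: ind_def C_def K_def)
        then show ?thesis by blast
      qed (use I in \<open>auto simp: ind_def\<close>)
    qed
    moreover have "finite C" using psubset.hyps by (simp add: C_def)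
    ultimately have "card (ind B) \<le> card (ind (B - {v})) + card (ind C)"
      using psubset.hyps fin
      by (meson card_Un_le card_image_le card_mono finite_Diff finite_UnI finite_imageI le_trans add_left_mono)
    then have "real (card (ind B)) \<le> real (card (ind (B - {v}))) + real (card (ind C))"
      by linarith
    also have "\<dots> \<le> 2 ^ m * (1 + \<epsilon>) ^ card (B - {v}) + 2 ^ m * (1 + \<epsilon>) ^ card C"
    proof (rule add_mono)
      show "real (card (ind (B - {v}))) \<le> 2 ^ m * (1 + \<epsilon>) ^ card (B - {v})"
        unfolding ind_def using v psubset.prems by (intro psubset.IH) auto
      show "real (card (ind C)) \<le> 2 ^ m * (1 + \<epsilon>) ^ card C"
        unfolding ind_def using v psubset.prems by (intro psubset.IH) (auto simp: C_def)
    qed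
    also have "\<dots> \<le> 2 ^ m * (1 + \<epsilon>) ^ (card B - 1) + 2 ^ m * (\<epsilon> * (1 + \<epsilon>) ^ (card B - 1))"
    proof -
      \<comment> \<open>The branch containing \<open>v\<close> loses \<open>v\<close> and at least
        \<open>d\<close> neighbours. The choice of \<epsilon> makes it at most \<epsilon> times the
        bound for the other branch, so one factor 1 + \<epsilon> pays for both.\<close>
      have "1 * (1 + \<epsilon>) ^ card C \<le> \<epsilon> * (1 + \<epsilon>) ^ d * (1 + \<epsilon>) ^ card C"
        using \<epsilon> by (intro mult_right_mono) auto
      also have "\<dots> = \<epsilon> * (1 + \<epsilon>) ^ (card C + d)" by (simp add: power_add)
      also have "\<dots> \<le> \<epsilon> * (1 + \<epsilon>) ^ (card B - 1)"
        using cC \<epsilon>(1) by (intro mult_left_mono power_increasing) auto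
      finally show ?thesis by (simp add: cB)
    qed
    also have "\<dots> = 2 ^ m * (1 + \<epsilon>) ^ Suc (card B - 1)" by (simp add: algebra_simps)
    finally show ?thesis using cB(2) by (simp add: ind_def)
  qed
qed

section \<open>Comparable pairs in large families, by random maximal chains\<close>

text \<open>The expected sum of \<open>g\<close> over a uniformly random maximal chain of subsets of \<open>S\<close>.\<close>

definition chain_mean :: "('a set \<Rightarrow> real) \<Rightarrow> 'a set \<Rightarrow> real" where
  "chain_mean g S = (\<Sum>A\<in>Pow S. g A / real (card S choose card A))"

text \<open>A random maximal chain of subsets of \<open>S\<close> starts at the top with
  \<open>S\<close> and continues as a random maximal chain of \<open>S - {i}\<close> for uniform
  \<open>i\<close>. In sums: a proper subset \<open>A\<close> lies in \<open>card S - card A\<close>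
  of the sets \<open>S - {i}\<close>, and binomial absorption adjusts the weights.\<close>

lemma chain_mean_rec:
  assumes "finite S" "S \<noteq> {}"
  shows "chain_mean g S = g S + (\<Sum>i\<in>S. chain_mean g (S - {i})) / real (card S)"
proof -
  let ?s = "card S"
  have s: "?s > 0" using assms by (simp add: card_gt_0_iff)
  have "(\<Sum>i\<in>S. chain_mean g (S - {i}))
      = (\<Sum>i\<in>S. \<Sum>A\<in>{A\<in>Pow S. i \<notin> A}. g A / real ((?s - 1) choose card A))"
    unfolding chain_mean_def using assms
    by (intro sum.cong) (auto intro!: sum.cong)
  also have "\<dots> = (\<Sum>A\<in>Pow S. \<Sum>i\<in>{i\<in>S. i \<notin> A}. g A / real ((?s - 1) choose card A))"
    using assms by (intro sum.swap_restrict) auto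
  also have "\<dots> = (\<Sum>A\<in>Pow S. real (?s - card A) * (g A / real ((?s - 1) choose card A)))"
  proof (intro sum.cong refl)
    fix A assume "A \<in> Pow S"
    then have "card {i\<in>S. i \<notin> A} = ?s - card A"
      using assms card_Diff_subset[of A S] by (simp add: set_diff_eq finite_subset)
    then show "(\<Sum>i\<in>{i\<in>S. i \<notin> A}. g A / real ((?s - 1) choose card A))
        = real (?s - card A) * (g A / real ((?s - 1) choose card A))" by simp
  qed
  \<comment> \<open>The term \<open>A = S\<close> is zero. It is removed first because its binomial
    coefficient is 0 and the comparison of fractions below needs positive denominators.\<close>
  also have "\<dots> = (\<Sum>A\<in>Pow S - {S}. real (?s - card A) * (g A / real ((?s - 1) choose card A)))"
    using assms by (intro sum.mono_neutral_right) auto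
  also have "\<dots> = (\<Sum>A\<in>Pow S - {S}. real ?s * (g A / real (?s choose card A)))"
  proof (intro sum.cong refl)
    fix A assume A: "A \<in> Pow S - {S}"
    then have lt: "card A < ?s" using assms by (auto intro: psubset_card_mono)
    have "real ?s * real ((?s - 1) choose card A) = real (?s - card A) * real (?s choose card A)"
      using binomial_absorb_comp[of ?s "card A"] by (metis of_nat_mult)
    moreover have "real ((?s - 1) choose card A) > 0" "real (?s choose card A) > 0"
      using lt by auto
    ultimately have "real (?s - card A) / real ((?s - 1) choose card A)
        = real ?s / real (?s choose card A)"
      by (simp add: frac_eq_eq)
    then show "real (?s - card A) * (g A / real ((?s - 1) choose card A))
        = real ?s * (g A / real (?s choose card A))"
      by (metis times_divide_eq_left times_divide_eq_right mult.commute)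
  qed
  also have "\<dots> = real ?s * (\<Sum>A\<in>Pow S - {S}. g A / real (?s choose card A))"
    by (simp add: sum_distrib_left)
  finally have "(\<Sum>i\<in>S. chain_mean g (S - {i})) / real ?s
      = (\<Sum>A\<in>Pow S - {S}. g A / real (?s choose card A))" using s by simp
  moreover have "chain_mean g S = g S / real (?s choose ?s)
      + (\<Sum>A\<in>Pow S - {S}. g A / real (?s choose card A))"
    unfolding chain_mean_def using assms by (intro sum.remove) auto
  ultimately show ?thesis by simp
qed

lemma chain_mean_nonneg: "(\<And>A. 0 \<le> g A) \<Longrightarrow> 0 \<le> chain_mean g S"
  unfolding chain_mean_def by (intro sum_nonneg) auto

text \<open>\<open>chain_mean p S\<close> is the expected number of nested pairs from
  \<open>\<A>\<close> on a random chain: given that it passes through \<open>B\<close>, the chain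
  meets \<open>A\<close> with probability 1 / (card B choose card A). A chain with k members has at
  least k - 1 pairs; the induction keeps only those whose upper set is the topmost member.\<close>

lemma chain_mean_le_one_plus_pairs:
  fixes \<A> :: "'a set set"
  assumes "finite S"
  defines "p \<equiv> \<lambda>B. of_bool (B \<in> \<A>) * (\<Sum>A\<in>{A\<in>\<A>. A \<subset> B}. 1 / real (card B choose card A))"
  shows "chain_mean (\<lambda>A. of_bool (A \<in> \<A>)) S \<le> 1 + chain_mean p S"
  using assms(1)
proof (induction "card S" arbitrary: S)
  case 0
  then have "S = {}" by simp
  then show ?case by (simp add: chain_mean_def p_def of_bool_def)
next
  case (Suc k)
  let ?l = "\<lambda>A. of_bool (A \<in> \<A>) :: real"
  have ne: "S \<noteq> {}" and fin: "finite S" using Suc by auto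
  have p: "0 \<le> p A" for A unfolding p_def by (intro mult_nonneg_nonneg sum_nonneg) auto
  have rest: "0 \<le> (\<Sum>i\<in>S. chain_mean p (S - {i})) / real (card S)"
    by (intro divide_nonneg_nonneg sum_nonneg chain_mean_nonneg p) auto
  show ?case
  proof (cases "S \<in> \<A>")
    case True
    have "chain_mean ?l S = ?l S / real (card S choose card S)
        + (\<Sum>A\<in>Pow S - {S}. ?l A / real (card S choose card A))"
      unfolding chain_mean_def using fin by (intro sum.remove) auto
    also have "(\<Sum>A\<in>Pow S - {S}. ?l A / real (card S choose card A)) = p S"
      using True fin unfolding p_def
      by (auto intro!: sum.mono_neutral_cong_right simp: psubset_eq)
    finally have "chain_mean ?l S = 1 + p S" using True by simp
    then show ?thesis using rest chain_mean_rec[OF fin ne, of p] by simp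
  next
    case False
    have "chain_mean ?l S = (\<Sum>i\<in>S. chain_mean ?l (S - {i})) / real (card S)"
      using False chain_mean_rec[OF fin ne, of ?l] by simp
    also have "\<dots> \<le> (\<Sum>i\<in>S. 1 + chain_mean p (S - {i})) / real (card S)"
      using Suc fin by (intro divide_right_mono sum_mono Suc.hyps) auto
    also have "\<dots> = 1 + (\<Sum>i\<in>S. chain_mean p (S - {i})) / real (card S)"
      using fin ne by (simp add: sum.distrib add_divide_distrib)
    also have "\<dots> = 1 + chain_mean p S"
      using False chain_mean_rec[OF fin ne, of p] by (simp add: p_def)
    finally show ?thesis .
  qed
qed

lemma binomial_ge_self:
  assumes "0 < k" "k < n"
  shows "n \<le> n choose k"
proof (cases "2 * k \<le> n")
  case True
  then show ?thesis using assms binomial_mono[of 1 k n] by simp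
next
  case False
  then show ?thesis
    using assms binomial_mono[of 1 "n - k" n] binomial_symmetric[of k n] by simp
qed

text \<open>Let \<open>W\<close> be the expected number of members on a random chain. Each
  comparable pair is charged to one of its members and costs at most 2/n of that member's weight; a
  member receives at most \<open>d\<close> charges, so W <= 1 + (2d/n) W. Every weight is at least
  1/N for the middle binomial N, which turns \<open>W\<close> into a cardinality. The empty set is
  excluded because every chain passes through it.\<close>

lemma card_le_of_bounded_comparability:
  fixes \<A> :: "nat set set"
  assumes \<A>: "\<A> \<subseteq> Pow {1..n} - {{}}"
    and deg: "\<And>A. A \<in> \<A> \<Longrightarrow> card {B\<in>\<A>. A \<subset> B \<or> B \<subset> A} \<le> d"
    and n: "n > 0"
  shows "(1 - 2 * real d / real n) * real (card \<A>) \<le> real (n choose (n div 2))"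
proof -
  define w where "w = (\<lambda>A :: nat set. 1 / real (n choose card A))"
  define W where "W = (\<Sum>A\<in>\<A>. w A)"
  have fin: "finite \<A>" using \<A> finite_subset by fastforce
  have sub: "A \<subseteq> {1..n}" "A \<noteq> {}" "finite A" "card A \<le> n" if "A \<in> \<A>" for A
    using \<A> that card_mono[of "{1..n}" A] by (auto intro: finite_subset)
  have w0: "0 \<le> w A" for A by (simp add: w_def)
  define big where "big = (\<lambda>A :: nat set. n \<le> 2 * card A)"
  define pairs where "pairs = {(A, B). A \<in> \<A> \<and> B \<in> \<A> \<and> A \<subset> B}"
  have finp: "finite pairs"
    using fin by (intro finite_subset[of pairs "\<A> \<times> \<A>"]) (auto simp: pairs_def)
  \<comment> \<open>A chain through \<open>h (A, B)\<close> meets the other member of the pair with probability at most \<open>2 / n\<close>.\<close>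
  define h where "h = (\<lambda>(A, B). if big B then B else A :: nat set)"
  have h\<A>: "h p \<in> \<A>" if "p \<in> pairs" for p
    using that by (auto simp: h_def pairs_def split: if_splits)
  have pair: "1 / (real (n choose card B) * real (card B choose card A)) \<le> 2 / real n * w (h (A, B))"
    if "(A, B) \<in> pairs" for A B
  proof -
    have AB: "A \<in> \<A>" "B \<in> \<A>" "card A < card B"
      using that sub by (auto simp: pairs_def intro: psubset_card_mono)
    have A0: "0 < card A" using sub[OF AB(1)] by (simp add: card_gt_0_iff)
    have Bn: "card B \<le> n" using sub AB by blast
    have pos: "real (n choose card A) > 0" "real (n choose card B) > 0"
      using AB Bn by auto
    have *: "1 / (c * b) \<le> 2 / real n * (1 / c)" if "n \<le> 2 * b" "c > 0" for b c :: real
      using that n by (simp add: field_simps)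
    show ?thesis
    proof (cases "big B")
      \<comment> \<open>A chain through \<open>B\<close> meets \<open>A\<close> with probability at
        most 1 / card B, and \<open>card B\<close> is at least n/2.\<close>
      case True
      then have "n \<le> 2 * (card B choose card A)"
        using binomial_ge_self[OF A0 AB(3)] by (simp add: big_def)
      then have "real n \<le> 2 * real (card B choose card A)" by linarith
      with * pos True show ?thesis by (simp add: h_def w_def)
    next
      \<comment> \<open>Now the pair is charged to \<open>A\<close>. The sets above \<open>A\<close>
        form a Boolean lattice of dimension \<open>n - card A\<close>, at least n/2, and
        \<open>B\<close> is neither its bottom nor its top; \<open>choose_mult\<close> reverses the
        order of conditioning.\<close>
      case False
      then have lt: "card B < n" and "n \<le> 2 * (n - card A)"
        using Bn AB(3) by (auto simp: big_def)
      moreover have "n - card A \<le> (n - card A) choose (card B - card A)"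
        using AB(3) lt by (intro binomial_ge_self) auto
      ultimately have "n \<le> 2 * ((n - card A) choose (card B - card A))" by linarith
      then have "real n \<le> 2 * real ((n - card A) choose (card B - card A))" by linarith
      moreover have "real (n choose card B) * real (card B choose card A)
          = real (n choose card A) * real ((n - card A) choose (card B - card A))"
        using choose_mult[of "card A" "card B" n] AB(3) Bn by (metis less_imp_le of_nat_mult)
      ultimately show ?thesis using * pos False by (simp add: h_def w_def)
    qed
  qed
  have "W = chain_mean (\<lambda>A. of_bool (A \<in> \<A>)) {1..n}"
    unfolding W_def chain_mean_def w_def using \<A>
    by (intro sum.mono_neutral_cong_left) auto
  also have "\<dots> \<le> 1 + chain_mean (\<lambda>B. of_bool (B \<in> \<A>) *
      (\<Sum>A\<in>{A\<in>\<A>. A \<subset> B}. 1 / real (card B choose card A))) {1..n}"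
    by (intro chain_mean_le_one_plus_pairs) auto
  also have "chain_mean (\<lambda>B. of_bool (B \<in> \<A>) *
      (\<Sum>A\<in>{A\<in>\<A>. A \<subset> B}. 1 / real (card B choose card A))) {1..n}
      = (\<Sum>B\<in>\<A>. \<Sum>A\<in>{A\<in>\<A>. A \<subset> B}. 1 / (real (n choose card B) * real (card B choose card A)))"
    unfolding chain_mean_def using \<A>
    by (intro sum.mono_neutral_cong_right) (auto simp: sum_divide_distrib mult.commute)
  also have "\<dots> = (\<Sum>(B, A)\<in>(SIGMA B:\<A>. {A\<in>\<A>. A \<subset> B}). 1 / (real (n choose card B) * real (card B choose card A)))"
    using fin by (intro sum.Sigma) auto
  also have "\<dots> = (\<Sum>(A, B)\<in>pairs. 1 / (real (n choose card B) * real (card B choose card A)))"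
    by (rule sum.reindex_bij_witness[of _ prod.swap prod.swap]) (auto simp: pairs_def)
  also have "\<dots> \<le> (\<Sum>p\<in>pairs. 2 / real n * w (h p))"
    using pair by (intro sum_mono) auto
  also have "\<dots> = (\<Sum>C\<in>\<A>. \<Sum>p\<in>{p\<in>pairs. h p = C}. 2 / real n * w (h p))"
    using fin finp h\<A> by (intro sum.group[symmetric]) auto
  also have "\<dots> = (\<Sum>C\<in>\<A>. real (card {p\<in>pairs. h p = C}) * (2 / real n * w C))"
    by (intro sum.cong) auto
  also have "\<dots> \<le> (\<Sum>C\<in>\<A>. real d * (2 / real n * w C))"
  proof (intro sum_mono mult_right_mono)
    fix C assume C: "C \<in> \<A>"
    \<comment> \<open>Hence the size of \<open>C\<close> decides whether \<open>C\<close> is the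
      upper or the lower set in all pairs charged to it. Such a pair is determined by its other set,
      and the degree bound applies.\<close>
    have up: "big B" if "big A" "(A, B) \<in> pairs" for A B
    proof -
      have "card A \<le> card B"
        using that sub by (intro card_mono) (auto simp: pairs_def)
      then show ?thesis using that(1) by (simp add: big_def)
    qed
    then have "inj_on (\<lambda>(A, B). if big C then A else B) {p\<in>pairs. h p = C}"
      by (auto simp: inj_on_def h_def split: if_splits)
    moreover have "(\<lambda>(A, B). if big C then A else B) ` {p\<in>pairs. h p = C} \<subseteq> {B\<in>\<A>. C \<subset> B \<or> B \<subset> C}"
      using up[unfolded pairs_def] by (fastforce simp: h_def pairs_def split: if_splits)
    ultimately have "card {p\<in>pairs. h p = C} \<le> card {B\<in>\<A>. C \<subset> B \<or> B \<subset> C}"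
      using fin by (intro card_inj_on_le) auto
    then show "real (card {p\<in>pairs. h p = C}) \<le> real d" using deg[OF C] by linarith
  qed (use w0 in auto)
  also have "\<dots> = 2 * real d / real n * W"
    unfolding W_def sum_distrib_left by (intro sum.cong) auto
  finally have W: "(1 - 2 * real d / real n) * W \<le> 1" by (simp add: algebra_simps)
  let ?N = "real (n choose (n div 2))"
  have N: "?N > 0" by simp
  have cW: "real (card \<A>) \<le> ?N * W"
  proof -
    have "real (card \<A>) = (\<Sum>A\<in>\<A>. 1)" by simp
    also have "\<dots> \<le> (\<Sum>A\<in>\<A>. ?N * w A)"
    proof (intro sum_mono)
      fix A assume "A \<in> \<A>"
      then have "real (n choose card A) > 0" using sub by simp
      moreover have "real (n choose card A) \<le> ?N"
        using binomial_maximum[of n "card A"] by linarith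
      ultimately show "1 \<le> ?N * w A" by (simp add: w_def field_simps)
    qed
    finally show ?thesis by (simp add: W_def sum_distrib_left)
  qed
  show ?thesis
  proof (cases "0 \<le> 1 - 2 * real d / real n")
    case True
    then have "(1 - 2 * real d / real n) * real (card \<A>) \<le> (1 - 2 * real d / real n) * (?N * W)"
      using cW by (intro mult_left_mono)
    also have "\<dots> = ?N * ((1 - 2 * real d / real n) * W)" by simp
    also have "\<dots> \<le> ?N * 1" using W N by (intro mult_left_mono) auto
    finally show ?thesis by simp
  next
    case False
    then have "(1 - 2 * real d / real n) * real (card \<A>) \<le> 0"
      by (intro mult_nonpos_nonneg) auto
    then show ?thesis using N by linarith
  qed
qed

section \<open>Size of the middle binomial coefficient\<close>

text \<open>From k to k + 1 the quotient (2k choose k) / 4^k changes by the factor (2k + 1) / (2k +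
  2), which is at least sqrt (k / (k + 1)) by the inequality of arithmetic and geometric means. So
  its product with sqrt k never decreases; the constant 2 gives equality at k = 1.\<close>

lemma central_binomial_sqrt_bound:
  assumes "k > 0"
  shows "4 ^ k \<le> 2 * sqrt (real k) * real ((2 * k) choose k)"
  using assms
proof (induction k rule: nat_induct_non_zero)
  case 1
  then show ?case by simp
next
  case (Suc k)
  let ?c = "real ((2 * k) choose k)"
  have "Suc k * Suc k * ((2 * Suc k) choose Suc k) = 2 * Suc k * (2 * k + 1) * ((2 * k) choose k)"
  proof -
    have 1: "Suc k * (Suc (2 * k + 1) choose Suc k) = Suc (2 * k + 1) * ((2 * k + 1) choose k)"
      using Suc_times_binomial_eq[of "2 * k + 1" k] by (simp only: mult.commute)
    have 2: "Suc k * ((2 * k + 1) choose Suc k) = (2 * k + 1) * ((2 * k) choose k)"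
      using Suc_times_binomial_eq[of "2 * k" k] by (simp add: mult.commute)
    have 3: "(2 * k + 1) choose k = (2 * k + 1) choose Suc k"
      using binomial_symmetric[of k "2 * k + 1"] by simp
    have "Suc k * Suc k * ((2 * Suc k) choose Suc k) = Suc k * (Suc k * (Suc (2 * k + 1) choose Suc k))"
    proof -
      have "2 * Suc k = Suc (2 * k + 1)" by simp
      then show ?thesis by (simp only: mult.assoc)
    qed
    also have "\<dots> = Suc (2 * k + 1) * (Suc k * ((2 * k + 1) choose Suc k))"
      unfolding 1 3 by (simp only: mult_ac)
    also have "\<dots> = 2 * Suc k * (2 * k + 1) * ((2 * k) choose k)"
      unfolding 2 by (simp add: algebra_simps)
    finally show ?thesis .
  qed
  then have "Suc k * (Suc k * ((2 * Suc k) choose Suc k)) = Suc k * (2 * (2 * k + 1) * ((2 * k) choose k))"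
    by (simp only: mult_ac)
  then have "real (Suc k * ((2 * Suc k) choose Suc k)) = real (2 * (2 * k + 1) * ((2 * k) choose k))"
    by (simp only: Suc_mult_cancel1)
  then have "real (Suc k) * real ((2 * Suc k) choose Suc k) = 2 * (2 * real k + 1) * ?c"
    by (simp only: of_nat_mult of_nat_add of_nat_numeral of_nat_1)
  then have rec: "real ((2 * Suc k) choose Suc k) = 2 * (2 * real k + 1) / real (Suc k) * ?c"
    by (simp add: field_simps)
  have sq: "2 * (sqrt (real k) * sqrt (real (Suc k))) \<le> 2 * real k + 1"
    using arith_geo_mean_sqrt[of "real k" "real (Suc k)"] by (simp add: real_sqrt_mult)
  have "4 ^ Suc k \<le> 4 * (2 * sqrt (real k) * ?c)" using Suc.IH by simp
  also have "\<dots> \<le> 2 * sqrt (real (Suc k)) * (2 * (2 * real k + 1) / real (Suc k) * ?c)"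
  proof -
    have "2 * sqrt (real k) \<le> (2 * real k + 1) / sqrt (real (Suc k))"
      using sq by (simp add: field_simps)
    also have "\<dots> = sqrt (real (Suc k)) * ((2 * real k + 1) / real (Suc k))"
      by (simp add: field_simps flip: power2_eq_square)
    finally have "2 * sqrt (real k) \<le> sqrt (real (Suc k)) * ((2 * real k + 1) / real (Suc k))" .
    then have "4 * ?c * (2 * sqrt (real k)) \<le> 4 * ?c * (sqrt (real (Suc k)) * ((2 * real k + 1) / real (Suc k)))"
      by (intro mult_left_mono) auto
    also have "\<dots> = 2 * sqrt (real (Suc k)) * (2 * (2 * real k + 1) / real (Suc k) * ?c)"
      unfolding times_divide_eq_right times_divide_eq_left by (simp only: mult_ac) simp
    finally show ?thesis by (simp only: mult_ac)
  qed
  finally show ?case unfolding rec .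
qed

text \<open>Measures the size of the Boolean lattice in units of its middle layer. For odd n the
  middle coefficient is half the central one for n + 1.\<close>

lemma two_power_le_sqrt_mult_middle_binomial:
  assumes "n > 0"
  shows "2 ^ n \<le> 2 * sqrt (real n) * real (n choose (n div 2))"
proof (cases "even n")
  case True
  then obtain k where k: "n = 2 * k" by blast
  have "2 ^ n = (4::real) ^ k" by (simp add: k power_mult)
  also have "\<dots> \<le> 2 * sqrt (real k) * real ((2 * k) choose k)"
    using assms k by (intro central_binomial_sqrt_bound) auto
  also have "\<dots> \<le> 2 * sqrt (real n) * real ((2 * k) choose k)"
    by (intro mult_right_mono) (auto simp: k)
  finally show ?thesis by (simp add: k)
next
  case False
  then obtain k where k: "n = 2 * k + 1" by (auto elim: oddE)
  have "(2 * Suc k) choose Suc k = 2 * (n choose k)"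
    using binomial_symmetric[of k "2 * k + 1"] by (simp add: k)
  moreover have "4 ^ Suc k \<le> 2 * sqrt (real (Suc k)) * real ((2 * Suc k) choose Suc k)"
    by (intro central_binomial_sqrt_bound) auto
  ultimately have "4 ^ Suc k \<le> 4 * sqrt (real (Suc k)) * real (n choose k)" by simp
  moreover have "4 ^ Suc k = 2 * (2::real) ^ n" by (simp add: k power_mult)
  ultimately have "2 ^ n \<le> 2 * sqrt (real (Suc k)) * real (n choose k)" by linarith
  also have "\<dots> \<le> 2 * sqrt (real n) * real (n choose k)"
    by (intro mult_right_mono) (auto simp: k)
  finally show ?thesis by (simp add: k)
qed

section \<open>Forests and cuts of the complete graph\<close>

text \<open>Apart from \<open>{}\<close>, the members of \<open>cuts n F\<close> are the hyperplanes containing \<open>F\<close>. They form a vector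
  space over \<open>GF(2)\<close> under symmetric difference, so that \<open>card (cuts n F)\<close> is a substitute for the rank.\<close>

definition cuts :: "nat \<Rightarrow> nat set set \<Rightarrow> nat set set" where
  "cuts n F = {A. A \<subseteq> {1..n} \<and> (\<forall>f\<in>F. f \<subseteq> A \<or> f \<inter> A = {})}"

definition forests :: "nat \<Rightarrow> nat set set set" where
  "forests n = indep (cycle_matroid (complete_graph_edges (n + 1)))"

lemma edgeE:
  assumes "f \<in> complete_graph_edges m"
  obtains u v where "f = {u, v}" "u \<noteq> v" "u \<in> {1..m}" "v \<in> {1..m}"
  using assms by (auto simp: complete_graph_edges_def)

lemma edgeI: "u \<in> {1..m} \<Longrightarrow> v \<in> {1..m} \<Longrightarrow> u \<noteq> v \<Longrightarrow> {u, v} \<in> complete_graph_edges m"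
  by (auto simp: complete_graph_edges_def)

lemma edge_subset: "f \<in> complete_graph_edges m \<Longrightarrow> f \<subseteq> {1..m}"
  by (auto elim!: edgeE)

lemma finite_complete_graph_edges: "finite (complete_graph_edges m)"
  by (rule finite_subset[of _ "Pow {1..m}"]) (use edge_subset in auto)

lemma finite_cuts [simp]: "finite (cuts n F)"
  by (rule finite_subset[of _ "Pow {1..n}"]) (auto simp: cuts_def)

lemma empty_in_cuts [simp]: "{} \<in> cuts n F"
  by (auto simp: cuts_def)

lemma card_cuts_pos: "0 < card (cuts n F)"
  by (metis card_gt_0_iff empty_iff empty_in_cuts finite_cuts)

lemma cuts_antimono: "F \<subseteq> G \<Longrightarrow> cuts n G \<subseteq> cuts n F"
  by (auto simp: cuts_def)

lemma cuts_insert: "cuts n (insert f F) = {A \<in> cuts n F. f \<subseteq> A \<or> f \<inter> A = {}}"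
  by (auto simp: cuts_def)

lemma cuts_Int: "A \<in> cuts n F \<Longrightarrow> B \<in> cuts n F \<Longrightarrow> A \<inter> B \<in> cuts n F"
  and cuts_Un: "A \<in> cuts n F \<Longrightarrow> B \<in> cuts n F \<Longrightarrow> A \<union> B \<in> cuts n F"
  unfolding cuts_def by blast+

lemma cuts_edge_iff: "A \<in> cuts n F \<Longrightarrow> {x, y} \<in> F \<Longrightarrow> x \<in> A \<longleftrightarrow> y \<in> A"
  by (auto simp: cuts_def)

lemma card_cuts_empty: "card (cuts n {}) = 2 ^ n"
proof -
  have "cuts n {} = Pow {1..n}" by (auto simp: cuts_def)
  then show ?thesis by (simp add: card_Pow)
qed

text \<open>Symmetric difference with \<open>A\<close> is an involution on \<open>cuts n F\<close>
  that exchanges the cuts separating \<open>u\<close> from \<open>v\<close> with the others. An edge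
  across a cut thus halves the count, that is, raises the rank by one.\<close>

lemma card_cuts_insert:
  assumes "A \<in> cuts n F" and cross: "u \<in> A" "v \<notin> A"
  shows "card (cuts n F) = 2 * card (cuts n (insert {u, v} F))"
proof -
  let ?C = "cuts n (insert {u, v} F)" and ?t = "\<lambda>B. (B - A) \<union> (A - B)"
  have sub: "?C \<subseteq> cuts n F" by (auto intro: cuts_antimono[THEN subsetD])
  have t: "?t B \<in> cuts n F" if "B \<in> cuts n F" for B
    using that assms(1) unfolding cuts_def by blast
  have tt: "?t (?t B) = B" for B by blast
  have "bij_betw ?t ?C (cuts n F - ?C)"
  proof (rule bij_betw_byWitness[where f' = ?t])
    show "?t ` ?C \<subseteq> cuts n F - ?C"
      using t sub cross by (auto simp: cuts_insert)
    show "?t ` (cuts n F - ?C) \<subseteq> ?C"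
      using t cross by (auto simp: cuts_insert)
  qed (use tt in blast)+
  then have "card (cuts n F - ?C) = card ?C" by (simp add: bij_betw_same_card)
  moreover have "card (cuts n F) = card ?C + card (cuts n F - ?C)"
    using sub by (metis card_Diff_subset card_mono finite_cuts finite_subset le_add_diff_inverse)
  ultimately show ?thesis by simp
qed

lemma card_cuts_insert_edge:
  assumes "f \<in> complete_graph_edges m" "A \<in> cuts n F" "\<not> (f \<subseteq> A \<or> f \<inter> A = {})"
  shows "card (cuts n F) = 2 * card (cuts n (insert f F))"
proof -
  obtain u v where f: "f = {u, v}" using assms(1) by (rule edgeE)
  then consider "u \<in> A" "v \<notin> A" | "v \<in> A" "u \<notin> A" using assms(3) by auto
  then show ?thesis
  proof cases
    case 1
    then show ?thesis unfolding f by (rule card_cuts_insert[OF assms(2)])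
  next
    case 2
    then show ?thesis unfolding f insert_commute[of u] by (rule card_cuts_insert[OF assms(2)])
  qed
qed

lemma card_cuts_insert_le:
  assumes "f \<in> complete_graph_edges m"
  shows "card (cuts n F) \<le> 2 * card (cuts n (insert f F))"
proof (cases "\<exists>A\<in>cuts n F. \<not> (f \<subseteq> A \<or> f \<inter> A = {})")
  case True
  then show ?thesis using card_cuts_insert_edge[OF assms] by fastforce
next
  case False
  then have "cuts n (insert f F) = cuts n F" by (auto simp: cuts_insert)
  then show ?thesis by simp
qed

text \<open>With \<open>card (cuts n F)\<close> read as 2^(n - r(F)), this is r(F) <= card
  F.\<close>

lemma card_cuts_ge:
  assumes "F \<subseteq> complete_graph_edges m"
  shows "2 ^ n \<le> card (cuts n F) * 2 ^ card F"
proof -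
  have "finite F" using assms finite_complete_graph_edges finite_subset by blast
  then show ?thesis using assms
  proof (induction F)
    case empty
    then show ?case by (simp add: card_cuts_empty)
  next
    case (insert f F)
    then have "2 ^ n \<le> card (cuts n F) * 2 ^ card F" by simp
    also have "\<dots> \<le> 2 * card (cuts n (insert f F)) * 2 ^ card F"
      using insert.prems card_cuts_insert_le[of f m n F] by (intro mult_right_mono) auto
    finally show ?case using insert.hyps by simp
  qed
qed

section \<open>Acyclicity as a count of cuts\<close>

text \<open>Membership in a cut is constant along a path, so the other edges of a cycle already
  prevent any cut from separating the ends of the closing edge.\<close>

lemma cycle_imp_redundant_edge:
  assumes "is_cycle C" "C \<subseteq> F"
  obtains f where "f \<in> F" "cuts n (F - {f}) = cuts n F"
proof -
  obtain vs where vs: "distinct vs" "length vs \<ge> 3" "C = cycle_edges vs"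
    using assms(1) by (auto simp: is_cycle_def)
  let ?l = "length vs"
  let ?f = "{vs ! (?l - 1), vs ! 0}"
  have "Suc (?l - 1) = ?l" using vs(2) by linarith
  then have "?f = {vs ! (?l - 1), vs ! (Suc (?l - 1) mod ?l)}" by (simp only: mod_self)
  moreover have "?l - 1 < ?l" using vs(2) by linarith
  ultimately have "?f \<in> C" unfolding vs(3) cycle_edges_def by blast
  then have fF: "?f \<in> F" using assms(2) by blast
  have path: "{vs ! i, vs ! Suc i} \<in> F - {?f}" if "Suc i < ?l" for i
  proof -
    have "{vs ! i, vs ! Suc i} \<in> C"
      unfolding vs(3) cycle_edges_def using that by (intro image_eqI[of _ _ i]) simp_all
    \<comment> \<open>Length at least 3 matters here: on two vertices the path edge would be the
      closing edge itself.\<close>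
    moreover have "{vs ! i, vs ! Suc i} \<noteq> ?f"
    proof -
      have "vs ! Suc i \<noteq> vs ! 0" "vs ! i = vs ! 0 \<longleftrightarrow> i = 0"
        "vs ! Suc i = vs ! (?l - 1) \<longleftrightarrow> Suc i = ?l - 1"
        using that vs(1,2) by (subst nth_eq_iff_index_eq; linarith?; simp)+
      then have "{vs ! i, vs ! Suc i} = ?f \<Longrightarrow> i = 0 \<and> Suc i = ?l - 1"
        unfolding doubleton_eq_iff by blast
      then show ?thesis using vs(2) by linarith
    qed
    ultimately show ?thesis using assms(2) by blast
  qed
  have "A \<in> cuts n F" if A: "A \<in> cuts n (F - {?f})" for A
  proof -
    have "vs ! i \<in> A \<longleftrightarrow> vs ! 0 \<in> A" if "i < ?l" for i
      using that
    proof (induction i)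
      case (Suc i)
      then show ?case using cuts_edge_iff[OF A path] by simp
    qed simp
    from this[of "?l - 1"] have "?f \<subseteq> A \<or> ?f \<inter> A = {}" using vs(2) by auto
    then have "A \<in> cuts n (insert ?f (F - {?f}))" using A by (simp only: cuts_insert) simp
    then show ?thesis using fF by (simp only: insert_Diff)
  qed
  then have "cuts n (F - {?f}) = cuts n F"
    using cuts_antimono[of "F - {?f}" F n] by auto
  then show ?thesis using fF that by blast
qed

text \<open>When a step returns to a vertex already on the path, the path is truncated
  there.\<close>

lemma rtrancl_distinct_path:
  assumes "(u, v) \<in> R\<^sup>*"
  obtains vs where "distinct vs" "vs \<noteq> []" "hd vs = u" "last vs = v"
    "\<And>i. Suc i < length vs \<Longrightarrow> (vs ! i, vs ! Suc i) \<in> R"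
proof -
  have "\<exists>vs. distinct vs \<and> vs \<noteq> [] \<and> hd vs = u \<and> last vs = v \<and>
      (\<forall>i. Suc i < length vs \<longrightarrow> (vs ! i, vs ! Suc i) \<in> R)"
    using assms
  proof (induction rule: rtrancl_induct)
    case base
    show ?case by (intro exI[of _ "[u]"]) simp
  next
    case (step y z)
    then obtain vs where vs: "distinct vs" "vs \<noteq> []" "hd vs = u" "last vs = y"
      "\<forall>i. Suc i < length vs \<longrightarrow> (vs ! i, vs ! Suc i) \<in> R" by blast
    show ?case
    proof (cases "z \<in> set vs")
      case True
      then obtain k where k: "k < length vs" "vs ! k = z" by (auto simp: in_set_conv_nth)
      then have "length vs \<le> Suc k \<Longrightarrow> length vs - Suc 0 = k" by linarith
      then show ?thesis
        using vs k by (intro exI[of _ "take (Suc k) vs"]) (auto simp: hd_conv_nth last_conv_nth min_def)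
    next
      case False
      have "((vs @ [z]) ! i, (vs @ [z]) ! Suc i) \<in> R" if "Suc i < length (vs @ [z])" for i
      proof (cases "Suc i < length vs")
        case True
        then show ?thesis using vs(5) by (simp add: nth_append)
      next
        case False
        then have "i = length vs - 1" "Suc i = length vs" using that by auto
        then show ?thesis using step.hyps(2) vs(2,4) by (simp add: nth_append last_conv_nth)
      qed
      then show ?thesis using vs False by (intro exI[of _ "vs @ [z]"]) auto
    qed
  qed
  then show ?thesis using that by blast
qed

text \<open>The component of \<open>u\<close> in \<open>F - {f}\<close> cannot contain
  \<open>v\<close>, since a path between them would form a cycle with \<open>f\<close>. So
  \<open>f\<close> leaves this component, and no other edge does.\<close>

lemma acyclic_imp_crossing_cut:
  assumes F: "F \<subseteq> complete_graph_edges (n + 1)" and f: "f \<in> F"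
    and acyclic: "\<not> (\<exists>C. is_cycle C \<and> C \<subseteq> F)"
  obtains A where "A \<in> cuts n (F - {f})" "\<not> (f \<subseteq> A \<or> f \<inter> A = {})"
proof -
  obtain u v where uv: "f = {u, v}" "u \<noteq> v" "u \<in> {1..n+1}" "v \<in> {1..n+1}"
    using subsetD[OF F f] by (rule edgeE)
  define R where "R = {(x, y). {x, y} \<in> F - {f}}"
  define K where "K = {x. (u, x) \<in> R\<^sup>*}"
  have K1: "g \<subseteq> K \<or> g \<inter> K = {}" if g: "g \<in> F - {f}" for g
  proof -
    have "g \<in> complete_graph_edges (n + 1)" using g F by blast
    then obtain x y where "g = {x, y}" by (rule edgeE)
    then have "(x, y) \<in> R" "(y, x) \<in> R" "g = {x, y}" using g by (auto simp: R_def insert_commute)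
    then show ?thesis unfolding K_def by (auto intro: rtrancl_into_rtrancl)
  qed
  have K2: "K \<subseteq> {1..n+1}"
  proof
    fix x assume "x \<in> K"
    then have "(u, x) \<in> R\<^sup>*" by (simp add: K_def)
    then show "x \<in> {1..n+1}"
    proof (cases rule: rtranclE)
      case (step y)
      then have "{y, x} \<in> complete_graph_edges (n + 1)" using F by (auto simp: R_def)
      then show ?thesis using edge_subset by blast
    qed (use uv in auto)
  qed
  have "v \<notin> K"
  proof
    assume "v \<in> K"
    then have "(u, v) \<in> R\<^sup>*" by (simp add: K_def)
    then obtain vs where vs: "distinct vs" "vs \<noteq> []" "hd vs = u" "last vs = v"
      and p: "\<And>i. Suc i < length vs \<Longrightarrow> (vs ! i, vs ! Suc i) \<in> R"
      by (rule rtrancl_distinct_path) blast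
    let ?l = "length vs"
    have ends: "vs ! 0 = u" "vs ! (?l - 1) = v"
      using vs by (auto simp: hd_conv_nth last_conv_nth)
    have "?l \<noteq> 1" using ends uv by auto
    \<comment> \<open>A path on two vertices would be \<open>f\<close> itself, which
      \<open>R\<close> excludes.\<close>
    moreover have "?l \<noteq> 2" using ends p[of 0] uv by (auto simp: R_def)
    ultimately have l: "?l \<ge> 3" using vs(2) by (cases ?l) auto
    have "cycle_edges vs \<subseteq> F"
    proof
      fix g assume "g \<in> cycle_edges vs"
      then obtain i where i: "i < ?l" "g = {vs ! i, vs ! (Suc i mod ?l)}"
        by (auto simp: cycle_edges_def)
      show "g \<in> F"
      proof (cases "Suc i < ?l")
        case True
        then show ?thesis using p[of i] i by (auto simp: R_def)
      next
        case False
        then have "i = ?l - 1" "Suc i = ?l" using i by auto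
        then show ?thesis using i ends uv f by (simp add: insert_commute)
      qed
    qed
    then show False using acyclic vs(1) l by (auto simp: is_cycle_def)
  qed
  moreover have uK: "u \<in> K" by (simp add: K_def)
  \<comment> \<open>The partition is represented by its side avoiding \<open>n + 1\<close>.\<close>
  moreover define A where "A = (if n + 1 \<in> K then {1..n+1} - K else K)"
  ultimately have "\<not> (f \<subseteq> A \<or> f \<inter> A = {})" using uv by auto
  moreover have "A \<in> cuts n (F - {f})"
  proof -
    have "A \<subseteq> {1..n+1} - {n+1}" using K2 by (auto simp: A_def)
    then have "A \<subseteq> {1..n}" by (auto simp: le_Suc_eq)
    moreover have "g \<subseteq> A \<or> g \<inter> A = {}" if "g \<in> F - {f}" for g
    proof -
      have "g \<subseteq> {1..n+1}" using that F edge_subset by blast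
      then show ?thesis using K1[OF that] by (auto simp: A_def)
    qed
    ultimately show ?thesis by (simp add: cuts_def)
  qed
  ultimately show ?thesis using that by blast
qed

text \<open>A forest is a set with r(F) = card F, written as a product to avoid truncated
  subtraction. In an acyclic set each edge crosses a cut of the others and halves the count;
  removing a redundant edge of a cycle would leave a set violating
  \<open>card_cuts_ge\<close>.\<close>

lemma forests_iff:
  "F \<in> forests n \<longleftrightarrow> F \<subseteq> complete_graph_edges (n + 1) \<and> card (cuts n F) * 2 ^ card F = 2 ^ n"
proof (cases "F \<subseteq> complete_graph_edges (n + 1)")
  case True
  then have "finite F" using finite_complete_graph_edges finite_subset by blast
  have "\<not> (\<exists>C. is_cycle C \<and> C \<subseteq> F) \<longleftrightarrow> card (cuts n F) * 2 ^ card F = 2 ^ n"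
  proof
    assume "\<not> (\<exists>C. is_cycle C \<and> C \<subseteq> F)"
    with \<open>finite F\<close> True show "card (cuts n F) * 2 ^ card F = 2 ^ n"
    proof (induction F)
      case empty
      then show ?case by (simp add: card_cuts_empty)
    next
      case (insert f F)
      then obtain A where "A \<in> cuts n (insert f F - {f})" "\<not> (f \<subseteq> A \<or> f \<inter> A = {})"
        using acyclic_imp_crossing_cut[of "insert f F" n f] by blast
      then have "card (cuts n F) = 2 * card (cuts n (insert f F))"
        using insert by (intro card_cuts_insert_edge) auto
      moreover have "card (cuts n F) * 2 ^ card F = 2 ^ n" using insert by blast
      ultimately show ?case using insert.hyps by simp
    qed
  next
    assume eq: "card (cuts n F) * 2 ^ card F = 2 ^ n"
    show "\<not> (\<exists>C. is_cycle C \<and> C \<subseteq> F)"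
    proof
      assume "\<exists>C. is_cycle C \<and> C \<subseteq> F"
      then obtain f where f: "f \<in> F" "cuts n (F - {f}) = cuts n F"
        using cycle_imp_redundant_edge by blast
      have "2 ^ n \<le> card (cuts n F) * 2 ^ card (F - {f})"
        using card_cuts_ge[of "F - {f}" "n + 1" n] True f by auto
      moreover have "card F = Suc (card (F - {f}))"
        using card_Suc_Diff1[OF \<open>finite F\<close> f(1)] by (rule sym)
      ultimately have "card (cuts n F) * 2 ^ card (F - {f}) * 2 \<le> card (cuts n F) * 2 ^ card (F - {f})"
        using eq by (simp only: power_Suc mult_ac)
      moreover have "0 < card (cuts n F) * 2 ^ card (F - {f})" using card_cuts_pos by simp
      ultimately show False by linarith
    qed
  qed
  then show ?thesis using True by (simp add: forests_def cycle_matroid_def)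
qed (simp add: forests_def cycle_matroid_def)

section \<open>Exchange, closure and flats expressed by cuts\<close>

lemma forest_subset_edges: "F \<in> forests n \<Longrightarrow> F \<subseteq> complete_graph_edges (n + 1)"
  by (simp add: forests_iff)

lemma finite_forest: "F \<in> forests n \<Longrightarrow> finite F"
  using forest_subset_edges finite_complete_graph_edges finite_subset by blast

lemma empty_forest: "{} \<in> forests n"
  by (simp add: forests_iff card_cuts_empty)

lemma forest_subset: "F \<in> forests n \<Longrightarrow> G \<subseteq> F \<Longrightarrow> G \<in> forests n"
  unfolding forests_def cycle_matroid_def by simp (meson subset_trans)

lemma card_forest_le: "F \<in> forests n \<Longrightarrow> card F \<le> n"
proof -
  assume "F \<in> forests n"
  then have "card (cuts n F) * 2 ^ card F = 2 ^ n" by (simp add: forests_iff)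
  moreover from this have "1 * 2 ^ card F \<le> card (cuts n F) * 2 ^ card F"
    using card_cuts_pos[of n F] by (intro mult_right_mono) auto
  ultimately have "(2::nat) ^ card F \<le> 2 ^ n" by simp
  then show "card F \<le> n" by simp
qed

lemma card_cuts_forest:
  assumes "F \<in> forests n"
  shows "card (cuts n F) = 2 ^ (n - card F)"
proof -
  have "card (cuts n F) * 2 ^ card F = 2 ^ (n - card F) * 2 ^ card F"
    using assms card_forest_le[OF assms] by (simp add: forests_iff flip: power_add)
  then show ?thesis by simp
qed

lemma insert_forest:
  assumes "F \<in> forests n" "f \<in> complete_graph_edges (n + 1)"
    "A \<in> cuts n F" "\<not> (f \<subseteq> A \<or> f \<inter> A = {})"
  shows "insert f F \<in> forests n" "f \<notin> F"
proof -
  show nf: "f \<notin> F" using assms by (auto simp: cuts_def)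
  then show "insert f F \<in> forests n"
    using assms card_cuts_insert_edge[OF assms(2,3,4)] finite_forest[OF assms(1)]
    by (auto simp: forests_iff)
qed

text \<open>\<open>cuts n X \<subseteq> cuts n Y\<close> says that \<open>Y\<close> lies in the
  closure of \<open>X\<close>. Unlike a comparison of sizes, this form of exchange also serves sets
  of equal size.\<close>

lemma forest_augment:
  assumes X: "X \<in> forests n" and Y: "Y \<in> forests n" and "\<not> cuts n X \<subseteq> cuts n Y"
  obtains y where "y \<in> Y" "y \<notin> X" "insert y X \<in> forests n"
proof -
  obtain A y where "A \<in> cuts n X" "y \<in> Y" "\<not> (y \<subseteq> A \<or> y \<inter> A = {})"
    using assms(3) by (auto simp: cuts_def)
  moreover have "y \<in> complete_graph_edges (n + 1)"
    using Y \<open>y \<in> Y\<close> forest_subset_edges by blast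
  ultimately show ?thesis using insert_forest[OF X] that by blast
qed

lemma forest_augment_card:
  assumes X: "X \<in> forests n" and Y: "Y \<in> forests n" and "card X < card Y"
  obtains y where "y \<in> Y" "y \<notin> X" "insert y X \<in> forests n"
proof -
  have "card (cuts n Y) < card (cuts n X)"
    using assms card_forest_le[OF Y] by (auto simp: card_cuts_forest)
  then have "\<not> cuts n X \<subseteq> cuts n Y" by (metis card_mono finite_cuts linorder_not_less)
  then show ?thesis using forest_augment[OF X Y] that by blast
qed

text \<open>\<open>cuts n J = cuts n X\<close> says that \<open>J\<close> spans \<open>X\<close>. An
  edge is kept exactly when it crosses a cut of the forest built so far.\<close>

lemma extend_to_spanning_forest:
  assumes F: "F \<in> forests n" and "F \<subseteq> X" "X \<subseteq> complete_graph_edges (n + 1)"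
  obtains J where "J \<in> forests n" "F \<subseteq> J" "J \<subseteq> X" "cuts n J = cuts n X"
proof -
  have "finite X" using assms(3) finite_complete_graph_edges finite_subset by blast
  \<comment> \<open>With \<open>F \<union> X\<close> in place of \<open>X\<close> the induction can
    start from \<open>F\<close> itself.\<close>
  then have "\<exists>J. J \<in> forests n \<and> F \<subseteq> J \<and> J \<subseteq> F \<union> X \<and> cuts n J = cuts n (F \<union> X)"
    using assms(3)
  proof (induction X)
    case empty
    then show ?case using F by auto
  next
    case (insert f X)
    then obtain J where J: "J \<in> forests n" "F \<subseteq> J" "J \<subseteq> F \<union> X" "cuts n J = cuts n (F \<union> X)" by auto
    have eq: "cuts n (insert f J) = cuts n (F \<union> insert f X)" using J(4) by (simp add: cuts_insert)
    show ?case
    proof (cases "\<exists>A\<in>cuts n J. \<not> (f \<subseteq> A \<or> f \<inter> A = {})")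
      case True
      then have "insert f J \<in> forests n" using insert_forest J(1) insert.prems by blast
      then show ?thesis using eq J(2,3) by (intro exI[of _ "insert f J"]) auto
    next
      case False
      then have "cuts n (insert f J) = cuts n J" by (auto simp: cuts_insert)
      then show ?thesis using eq J by (intro exI[of _ J]) auto
    qed
  qed
  moreover have "F \<union> X = X" using assms(2) by blast
  ultimately show ?thesis using that by auto
qed

lemma card_cuts_insert_forest:
  assumes "F \<in> forests n" "insert f F \<in> forests n" "f \<notin> F"
  shows "card (cuts n F) = 2 * card (cuts n (insert f F))"
proof -
  have "card (insert f F) = Suc (card F)" using assms(3) finite_forest[OF assms(1)] by simp
  then show ?thesis
    using card_cuts_forest[OF assms(1)] card_cuts_forest[OF assms(2)] card_forest_le[OF assms(2)]
    by (simp flip: power_Suc add: Suc_diff_le)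
qed

lemma ex_nonempty_cut:
  assumes "F \<in> forests n" "card F < n"
  obtains A where "A \<in> cuts n F" "A \<noteq> {}"
proof -
  have "\<not> cuts n F \<subseteq> {{}}"
  proof
    assume "cuts n F \<subseteq> {{}}"
    then have "card (cuts n F) \<le> card {{} :: nat set}" by (intro card_mono) auto
    moreover have "(2::nat) ^ 1 \<le> 2 ^ (n - card F)" using assms(2) by (intro power_increasing) auto
    ultimately show False by (simp add: card_cuts_forest[OF assms(1)])
  qed
  then show ?thesis using that by blast
qed

lemma ex_full_forest: obtains B where "B \<in> forests n" "card B = n"
proof -
  obtain B where B: "B \<in> forests n" "{} \<subseteq> B" "B \<subseteq> complete_graph_edges (n + 1)"
    "cuts n B = cuts n (complete_graph_edges (n + 1))"
    by (rule extend_to_spanning_forest[OF empty_forest empty_subsetI order_refl])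
  \<comment> \<open>Every other vertex is joined to \<open>n + 1\<close>, which lies in no
    cut.\<close>
  have "A = {}" if A: "A \<in> cuts n (complete_graph_edges (n + 1))" for A
  proof -
    have A': "A \<subseteq> {1..n}" using A by (simp add: cuts_def)
    have "x \<notin> A" for x
    proof
      assume x: "x \<in> A"
      then have "x \<in> {1..n}" using A' by blast
      then have "{x, n + 1} \<in> complete_graph_edges (n + 1)"
        by (intro edgeI) auto
      then have "n + 1 \<in> A" using cuts_edge_iff[OF A] x by blast
      then show False using A' by auto
    qed
    then show ?thesis by blast
  qed
  then have "cuts n B = {{}}" using B(4) by auto
  then have "(2::nat) ^ (n - card B) = 1" using card_cuts_forest[OF B(1)] by simp
  then have "card B = n" using card_forest_le[OF B(1)] by simp
  then show ?thesis using B that by blast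
qed

text \<open>The set \<open>X\<close> below is a flat: the union of the cliques on \<open>A\<close>,
  on \<open>B\<close> and on the remaining vertices. The last class contains \<open>n + 1\<close>,
  so every cut is a union of some of \<open>A\<close> and \<open>B\<close>. The corank is two if
  both are nonempty; for nonempty \<open>A\<close> and \<open>B = {}\<close> the flat is a
  hyperplane.\<close>

lemma forest_with_two_parts:
  assumes AB: "A \<subseteq> {1..n}" "B \<subseteq> {1..n}" "A \<inter> B = {}"
    and I: "I \<in> forests n" "A \<in> cuts n I" "B \<in> cuts n I"
  obtains J where "J \<in> forests n" "I \<subseteq> J" "cuts n J = {{}, A, B, A \<union> B}"
proof -
  let ?E = "complete_graph_edges (n + 1)"
  define X where "X = {f \<in> ?E. (f \<subseteq> A \<or> f \<inter> A = {}) \<and> (f \<subseteq> B \<or> f \<inter> B = {})}"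
  have "I \<subseteq> X" using I(2,3) forest_subset_edges[OF I(1)] by (auto simp: X_def cuts_def)
  moreover have "X \<subseteq> ?E" by (auto simp: X_def)
  ultimately obtain J where J: "J \<in> forests n" "I \<subseteq> J" "J \<subseteq> X" "cuts n J = cuts n X"
    by (rule extend_to_spanning_forest[OF I(1)])
  have edge: "{x, y} \<in> X" if "x \<in> {1..n+1}" "y \<in> {1..n+1}" "x \<noteq> y" "x \<in> A \<longleftrightarrow> y \<in> A" "x \<in> B \<longleftrightarrow> y \<in> B" for x y
  proof -
    have "{x, y} \<in> ?E"
      using that(1-3) by (rule edgeI)
    then show ?thesis using that(4,5) by (simp add: X_def)
  qed
  have "C \<in> {{}, A, B, A \<union> B}" if C: "C \<in> cuts n X" for C
  proof -
    have C': "C \<subseteq> {1..n}" using C by (simp add: cuts_def)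
    have same: "x \<in> C \<longleftrightarrow> y \<in> C" if "x \<in> {1..n+1}" "y \<in> {1..n+1}" "x \<in> A \<longleftrightarrow> y \<in> A" "x \<in> B \<longleftrightarrow> y \<in> B" for x y
    proof (cases "x = y")
      case False
      show ?thesis by (rule cuts_edge_iff[OF C edge[OF that(1,2) False that(3,4)]])
    qed simp
    have n1: "n + 1 \<notin> A" "n + 1 \<notin> B" "n + 1 \<notin> C" using AB C' by auto
    have "C \<subseteq> A \<union> B"
    proof
      fix x assume "x \<in> C"
      then show "x \<in> A \<union> B" using same[of x "n + 1"] C' n1 by fastforce
    qed
    moreover have "A \<subseteq> C \<or> A \<inter> C = {}"
    proof -
      have "y \<in> C" if "x \<in> A" "x \<in> C" "y \<in> A" for x y
        using same[of x y] that AB by fastforce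
      then show ?thesis by blast
    qed
    moreover have "B \<subseteq> C \<or> B \<inter> C = {}"
    proof -
      have "y \<in> C" if "x \<in> B" "x \<in> C" "y \<in> B" for x y
        using same[of x y] that AB by fastforce
      then show ?thesis by blast
    qed
    ultimately show ?thesis by blast
  qed
  then have "cuts n X \<subseteq> {{}, A, B, A \<union> B}" by (rule subsetI)
  moreover have "A \<in> cuts n X" "B \<in> cuts n X" using AB by (auto simp: cuts_def X_def)
  ultimately have "cuts n X = {{}, A, B, A \<union> B}" by (simp add: cuts_Un subset_antisym)
  then show ?thesis using J that by simp
qed

lemma forest_with_part:
  assumes "I \<in> forests n" "A \<in> cuts n I"
  obtains J where "J \<in> forests n" "I \<subseteq> J" "cuts n J = {{}, A}"
proof -
  have "A \<subseteq> {1..n}" using assms(2) by (simp add: cuts_def)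
  then obtain J where "J \<in> forests n" "I \<subseteq> J" "cuts n J = {{}, A, {}, A \<union> {}}"
    using assms by (rule forest_with_two_parts[OF _ empty_subsetI Int_empty_right _ _ empty_in_cuts])
  moreover have "{{}, A, {}, A \<union> {}} = {{}, A}" by auto
  ultimately show ?thesis using that by metis
qed

lemma forest_with_single_cut:
  assumes "A \<subseteq> {1..n}"
  obtains J where "J \<in> forests n" "cuts n J = {{}, A}"
proof -
  have "A \<in> cuts n {}" using assms by (simp add: cuts_def)
  with empty_forest obtain J where "J \<in> forests n" "{} \<subseteq> J" "cuts n J = {{}, A}"
    by (rule forest_with_part)
  then show ?thesis using that by blast
qed

section \<open>Extensions from intersecting antichains\<close>

text \<open>\<open>\<A>\<close> prescribes which hyperplanes span \<open>e\<close>: the new element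
  is in the closure of a forest \<open>I\<close> when every hyperplane containing \<open>I\<close>
  belongs to \<open>\<A>\<close>.\<close>

definition cut_extension :: "nat \<Rightarrow> nat set \<Rightarrow> nat set set \<Rightarrow> nat set set_system" where
  "cut_extension n e \<A> =
     \<lparr>ground = insert e (complete_graph_edges (n + 1)),
      indep = forests n \<union> {insert e I | I. I \<in> forests n \<and> (\<exists>A\<in>cuts n I. A \<noteq> {} \<and> A \<notin> \<A>)}\<rparr>"

lemma new_notin_forest: "e \<notin> complete_graph_edges (n + 1) \<Longrightarrow> I \<in> forests n \<Longrightarrow> e \<notin> I"
  using forest_subset_edges by blast

lemma insert_in_cut_extension:
  assumes "e \<notin> complete_graph_edges (n + 1)" "e \<notin> I"
  shows "insert e I \<in> indep (cut_extension n e \<A>)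
    \<longleftrightarrow> I \<in> forests n \<and> (\<exists>A\<in>cuts n I. A \<noteq> {} \<and> A \<notin> \<A>)"
proof -
  have "insert e I \<notin> forests n" using new_notin_forest[OF assms(1)] by blast
  moreover have "I = J" if "insert e I = insert e J" "J \<in> forests n" for J
    using that assms(2) new_notin_forest[OF assms(1)] by (metis insert_ident)
  ultimately have "insert e I \<in> forests n \<union> {insert e I | I. I \<in> forests n \<and> P I} \<longleftrightarrow> I \<in> forests n \<and> P I" for P
    by blast
  then show ?thesis by (simp add: cut_extension_def)
qed

lemma cut_extension_cases:
  assumes "e \<notin> complete_graph_edges (n + 1)" "X \<in> indep (cut_extension n e \<A>)"
  obtains "e \<notin> X" "X \<in> forests n"
  | I A where "X = insert e I" "e \<notin> I" "I \<in> forests n" "A \<in> cuts n I" "A \<noteq> {}" "A \<notin> \<A>"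
  using assms(2) new_notin_forest[OF assms(1)] unfolding cut_extension_def by auto

text \<open>A spanning forest \<open>J\<close> of the hyperplane \<open>A\<close> has
  \<open>A\<close> as its only nonempty cut, so the independence of \<open>insert e J\<close>
  reveals whether \<open>A\<close> belongs to the family.\<close>

lemma inj_on_cut_extension:
  assumes e: "e \<notin> complete_graph_edges (n + 1)"
  shows "inj_on (cut_extension n e) (Pow (Pow {1..n} - {{}}))"
proof (rule inj_onI)
  fix \<A> \<B> assume *: "\<A> \<in> Pow (Pow {1..n} - {{}})" "\<B> \<in> Pow (Pow {1..n} - {{}})"
    and eq: "cut_extension n e \<A> = cut_extension n e \<B>"
  have "A \<in> \<A> \<longleftrightarrow> A \<in> \<B>" if A: "A \<in> Pow {1..n} - {{}}" for A
  proof -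
    from A have "A \<subseteq> {1..n}" by blast
    then obtain J where J: "J \<in> forests n" "cuts n J = {{}, A}" by (rule forest_with_single_cut)
    have "insert e J \<in> indep (cut_extension n e \<C>) \<longleftrightarrow> A \<notin> \<C>" for \<C>
      using insert_in_cut_extension[OF e new_notin_forest[OF e J(1)], of \<C>] J A by auto
    then show ?thesis using eq by metis
  qed
  then show "\<A> = \<B>" using * by blast
qed

text \<open>This is exchange for \<open>insert e X\<close>: after adding \<open>y\<close> some
  hyperplane outside \<open>\<A>\<close> must remain. Otherwise there are distinct cuts
  \<open>P\<close> of \<open>insert y1 X\<close> and \<open>Q\<close> of \<open>insert y2 X\<close>,
  both in \<open>\<A>\<close>. They meet, and \<open>P \<inter> Q\<close> or
  \<open>P \<union> Q\<close> is again a cut of \<open>insert y1 X\<close> and hence in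
  \<open>\<A>\<close>, contradicting the antichain property. \<open>Y_out\<close> covers larger sets
  with and without \<open>e\<close>.\<close>

lemma ex_cut_outside_family:
  assumes intersecting: "\<And>A B. A \<in> \<A> \<Longrightarrow> B \<in> \<A> \<Longrightarrow> A \<inter> B \<noteq> {}"
    and antichain: "\<And>A B. A \<in> \<A> \<Longrightarrow> B \<in> \<A> \<Longrightarrow> A \<subseteq> B \<Longrightarrow> A = B"
    and X: "X \<in> forests n" and Y: "Y \<in> forests n" and lt: "card X < card Y" "Suc (card X) < n"
    and Y_out: "Suc (card X) < card Y \<or> (\<exists>A\<in>cuts n Y. A \<noteq> {} \<and> A \<notin> \<A>)"
  shows "\<exists>y A. y \<in> Y \<and> y \<notin> X \<and> insert y X \<in> forests n \<and>
    A \<in> cuts n (insert y X) \<and> A \<noteq> {} \<and> A \<notin> \<A>"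
proof (rule ccontr)
  assume contra: "\<not> ?thesis"
  then have all: "A \<in> \<A>" if "y \<in> Y" "y \<notin> X" "insert y X \<in> forests n"
    "A \<in> cuts n (insert y X)" "A \<noteq> {}" for y A
    using that by blast
  obtain y1 where y1: "y1 \<in> Y" "y1 \<notin> X" "insert y1 X \<in> forests n"
    using X Y lt(1) by (rule forest_augment_card)
  have card1: "card (insert y1 X) = Suc (card X)" using y1(2) finite_forest[OF X] by simp
  \<comment> \<open>If \<open>insert y1 X\<close> spanned \<open>Y\<close>, both would have the same
    rank and the same cuts, so all nonempty cuts of \<open>Y\<close> would lie in
    \<open>\<A>\<close>, against \<open>Y_out\<close>.\<close>
  have "\<not> cuts n (insert y1 X) \<subseteq> cuts n Y"
  proof
    assume sub: "cuts n (insert y1 X) \<subseteq> cuts n Y"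
    then have "card (cuts n (insert y1 X)) \<le> card (cuts n Y)" by (intro card_mono) auto
    then have "n - Suc (card X) \<le> n - card Y"
      using card_cuts_forest[OF y1(3)] card_cuts_forest[OF Y] card1 by simp
    then have cY: "card Y = Suc (card X)" using card_forest_le[OF Y] lt by linarith
    then have "card (cuts n (insert y1 X)) = card (cuts n Y)"
      using card_cuts_forest[OF y1(3)] card_cuts_forest[OF Y] card1 by simp
    then have "cuts n (insert y1 X) = cuts n Y" using sub by (intro card_subset_eq) auto
    then show False using all[OF y1] Y_out cY by auto
  qed
  then obtain P where P: "P \<in> cuts n (insert y1 X)" "P \<notin> cuts n Y" by blast
  have PX: "P \<in> cuts n X" using P(1) cuts_antimono[of X "insert y1 X" n] by blast
  obtain y2 where y2: "y2 \<in> Y" "\<not> (y2 \<subseteq> P \<or> y2 \<inter> P = {})"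
    using P PX by (auto simp: cuts_def)
  have "y2 \<in> complete_graph_edges (n + 1)" using y2(1) forest_subset_edges[OF Y] by blast
  then have y2X: "insert y2 X \<in> forests n" "y2 \<notin> X"
    using insert_forest[OF X _ PX y2(2)] by blast+
  \<comment> \<open>The forest \<open>insert y2 X\<close> stays below full rank, so it has a
    nonempty cut.\<close>
  then have "card (insert y2 X) < n" using lt(2) finite_forest[OF X] by simp
  with y2X(1) obtain Q where Q: "Q \<in> cuts n (insert y2 X)" "Q \<noteq> {}" by (rule ex_nonempty_cut)
  have QX: "Q \<in> cuts n X" using Q(1) cuts_antimono[of X "insert y2 X" n] by blast
  have "P \<noteq> {}" using P(2) by auto
  then have P\<A>: "P \<in> \<A>" using all[OF y1 P(1)] by blast
  have Q\<A>: "Q \<in> \<A>" using all[OF y2(1) y2X(2,1) Q] .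
  have "P \<noteq> Q" using y2(2) Q(1) by (auto simp: cuts_insert)
  then have npq: "\<not> P \<subseteq> Q" "\<not> Q \<subseteq> P" using antichain P\<A> Q\<A> by blast+
  have "P \<inter> Q \<notin> \<A>" using antichain[OF _ P\<A>, of "P \<inter> Q"] npq(1) by blast
  then have "P \<inter> Q \<notin> cuts n (insert y1 X)"
    using all[OF y1, of "P \<inter> Q"] intersecting[OF P\<A> Q\<A>] by blast
  then have "\<not> (y1 \<subseteq> P \<inter> Q \<or> y1 \<inter> (P \<inter> Q) = {})"
    using cuts_Int[OF PX QX] by (simp add: cuts_insert)
  \<comment> \<open>As \<open>y1\<close> meets \<open>P \<inter> Q\<close> without crossing
    \<open>P\<close>, it lies inside \<open>P\<close> and cannot cross
    \<open>P \<union> Q\<close>.\<close>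
  moreover have "y1 \<subseteq> P \<or> y1 \<inter> P = {}" using P(1) by (simp add: cuts_insert)
  ultimately have "y1 \<subseteq> P \<union> Q" by blast
  then have "P \<union> Q \<in> cuts n (insert y1 X)" using cuts_Un[OF PX QX] by (simp add: cuts_insert)
  then have "P \<union> Q \<in> \<A>" using all[OF y1] \<open>P \<noteq> {}\<close> by blast
  then show False using antichain[OF P\<A>, of "P \<union> Q"] npq(2) by blast
qed

lemma matroid_cut_extension:
  assumes e: "e \<notin> complete_graph_edges (n + 1)"
    and intersecting: "\<And>A B. A \<in> \<A> \<Longrightarrow> B \<in> \<A> \<Longrightarrow> A \<inter> B \<noteq> {}"
    and antichain: "\<And>A B. A \<in> \<A> \<Longrightarrow> B \<in> \<A> \<Longrightarrow> A \<subseteq> B \<Longrightarrow> A = B"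
  shows "matroid (cut_extension n e \<A>)"
proof -
  let ?N = "cut_extension n e \<A>"
  have "finite (ground ?N)" by (simp add: cut_extension_def finite_complete_graph_edges)
  moreover have "indep ?N \<subseteq> Pow (ground ?N)"
    using forest_subset_edges unfolding cut_extension_def by fastforce
  moreover have "{} \<in> indep ?N" using empty_forest by (simp add: cut_extension_def)
  moreover have forest: "X \<in> indep ?N" if "X \<in> forests n" for X
    using that by (simp add: cut_extension_def)
  have down: "X \<in> indep ?N" if "Y \<in> indep ?N" "X \<subseteq> Y" for X Y
    using e that(1)
  proof (cases rule: cut_extension_cases)
    case 1
    then show ?thesis using forest forest_subset that(2) by blast
  next
    case (2 I A)
    have XI: "X - {e} \<subseteq> I" using 2(1) that(2) by blast
    then have F: "X - {e} \<in> forests n" using forest_subset 2(3) by blast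
    show ?thesis
    proof (cases "e \<in> X")
      case True
      have "A \<in> cuts n (X - {e})" using cuts_antimono[OF XI] 2(4) by blast
      then have "insert e (X - {e}) \<in> indep ?N"
        using 2(5,6) F insert_in_cut_extension[OF e, of "X - {e}" \<A>] by blast
      then show ?thesis using True by (simp add: insert_absorb)
    next
      case False
      then show ?thesis using F forest by simp
    qed
  qed
  moreover have "\<exists>y\<in>Y - X. insert y X \<in> indep ?N"
    if X: "X \<in> indep ?N" and Y: "Y \<in> indep ?N" and lt: "card X < card Y" for X Y
    using e X
  proof (cases rule: cut_extension_cases)
    case X1: 1
    show ?thesis using e Y
    proof (cases rule: cut_extension_cases)
      case 1
      obtain y where "y \<in> Y" "y \<notin> X" "insert y X \<in> forests n"
        using X1(2) 1(2) lt by (rule forest_augment_card)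
      then show ?thesis using forest by blast
    next
      case (2 I A)
      have cI: "card Y = Suc (card I)" using 2(1,2) finite_forest[OF 2(3)] by simp
      show ?thesis
      \<comment> \<open>\<open>I\<close> has at least as many edges as \<open>X\<close>. If it lies
        in the closure of \<open>X\<close>, both span the same flat and \<open>e\<close> itself can
        be added; otherwise an edge of \<open>I\<close> can.\<close>
      proof (cases "cuts n X \<subseteq> cuts n I")
        case True
        then have "card (cuts n X) \<le> card (cuts n I)" by (intro card_mono) auto
        moreover have "n - card I \<le> n - card X" using cI lt by linarith
        then have "card (cuts n I) \<le> card (cuts n X)"
          by (simp add: card_cuts_forest[OF 2(3)] card_cuts_forest[OF X1(2)])
        ultimately have "cuts n X = cuts n I" using True by (intro card_subset_eq) auto
        then have "insert e X \<in> indep ?N"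
          using insert_in_cut_extension[OF e X1(1), of \<A>] X1(2) 2(4-6) by blast
        then show ?thesis using X1(1) 2(1) by blast
      next
        case False
        obtain y where "y \<in> I" "y \<notin> X" "insert y X \<in> forests n"
          using X1(2) 2(3) False by (rule forest_augment)
        then show ?thesis using forest 2(1) by blast
      qed
    qed
  next
    case (2 I A)
    have cX: "card X = Suc (card I)" using 2(1,2) finite_forest[OF 2(3)] by simp
    have goal: ?thesis if "y \<in> Y" "y \<notin> I" "y \<noteq> e" "insert y I \<in> forests n" "B \<in> cuts n (insert y I)" "B \<noteq> {}" "B \<notin> \<A>" for y B
    proof -
      have "insert e (insert y I) \<in> indep ?N"
        using insert_in_cut_extension[OF e, of "insert y I" \<A>] that(3-7) 2(2) by auto
      then have "insert y X \<in> indep ?N" unfolding 2(1) by (simp add: insert_commute)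
      moreover have "y \<in> Y - X" using that(1-3) 2(1) by simp
      ultimately show ?thesis by (rule bexI)
    qed
    show ?thesis using e Y
    proof (cases rule: cut_extension_cases)
      case Y1: 1
      have l: "card I < card Y" "Suc (card I) < n" "Suc (card I) < card Y"
        using lt cX card_forest_le[OF Y1(2)] by linarith+
      obtain y B where "y \<in> Y" "y \<notin> I" "insert y I \<in> forests n" "B \<in> cuts n (insert y I)" "B \<noteq> {}" "B \<notin> \<A>"
        using ex_cut_outside_family[OF intersecting antichain 2(3) Y1(2) l(1,2) disjI1[OF l(3)]] by blast
      then show ?thesis using goal[of y B] Y1(1) by blast
    next
      case Y2: (2 J C)
      have cY: "card Y = Suc (card J)" using Y2(1,2) finite_forest[OF Y2(3)] by simp
      \<comment> \<open>This supplies the bound \<open>Suc (card I) < n\<close>; a forest of full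
        rank would have no nonempty cut.\<close>
      have "card J < n"
      proof (rule ccontr)
        assume "\<not> card J < n"
        then have "card (cuts n J) = 1" using card_cuts_forest[OF Y2(3)] by simp
        then have "cuts n J = {{}}" using empty_in_cuts by (metis card_1_singletonE singletonD)
        then show False using Y2(4,5) by blast
      qed
      then have l: "card I < card J" "Suc (card I) < n" using lt cX cY by linarith+
      have out: "Suc (card I) < card J \<or> (\<exists>A\<in>cuts n J. A \<noteq> {} \<and> A \<notin> \<A>)" using Y2(4-6) by blast
      obtain y B where "y \<in> J" "y \<notin> I" "insert y I \<in> forests n" "B \<in> cuts n (insert y I)" "B \<noteq> {}" "B \<notin> \<A>"
        using ex_cut_outside_family[OF intersecting antichain 2(3) Y2(3) l out] by blast
      then show ?thesis using goal[of y B] Y2(1,2) by blast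
    qed
  qed
  ultimately show ?thesis unfolding matroid_def by blast
qed

lemma cut_extension_in_extensions:
  assumes e: "e \<notin> complete_graph_edges (n + 1)"
    and "\<And>A B. A \<in> \<A> \<Longrightarrow> B \<in> \<A> \<Longrightarrow> A \<inter> B \<noteq> {}"
    and "\<And>A B. A \<in> \<A> \<Longrightarrow> B \<in> \<A> \<Longrightarrow> A \<subseteq> B \<Longrightarrow> A = B"
  shows "cut_extension n e \<A> \<in> extensions (cycle_matroid (complete_graph_edges (n + 1))) e"
proof -
  let ?N = "cut_extension n e \<A>" and ?M = "cycle_matroid (complete_graph_edges (n + 1))"
  have m: "matroid ?N" using assms by (rule matroid_cut_extension)
  have gM: "ground ?M = complete_graph_edges (n + 1)" by (simp add: cycle_matroid_def)
  have gN: "ground ?N = insert e (complete_graph_edges (n + 1))" by (simp add: cut_extension_def)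
  have "{X \<in> indep ?N. e \<notin> X} = indep ?M"
    using new_notin_forest[OF e] unfolding cut_extension_def forests_def by auto
  then have del: "deletion ?N e = ?M" using e gM gN by (simp add: deletion_def)
  obtain B where B: "B \<in> forests n" "card B = n" by (rule ex_full_forest)
  \<comment> \<open>A full forest has only the empty cut, so \<open>e\<close> cannot be added to it.
    It is a basis avoiding \<open>e\<close>, hence \<open>e\<close> is not a coloop.\<close>
  have "basis ?N B"
    unfolding basis_def
  proof (intro conjI ballI impI)
    show "B \<in> indep ?N" using B by (simp add: cut_extension_def)
    fix X assume X: "X \<in> indep ?N" and BX: "B \<subseteq> X"
    have maximal: "F = B" if "F \<in> forests n" "B \<subseteq> F" for F
      using that B card_forest_le[OF that(1)] finite_forest[OF that(1)] by (metis card_seteq)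
    show "X = B" using e X
    proof (cases rule: cut_extension_cases)
      case 1
      then show ?thesis using maximal BX by blast
    next
      case (2 I A)
      then have "I = B" using maximal BX new_notin_forest[OF e B(1)] by blast
      then have "card (cuts n I) = 1" using card_cuts_forest[OF B(1)] B(2) by simp
      then have "cuts n I = {{}}" using empty_in_cuts by (metis card_1_singletonE singletonD)
      then show ?thesis using 2(4,5) by blast
    qed
  qed
  then have "\<not> coloop ?N e" using new_notin_forest[OF e B(1)] by (auto simp: coloop_def)
  then show ?thesis using m del gN gM unfolding extensions_def is_extension_def by blast
qed

section \<open>The spanning hyperplanes of an extension\<close>

text \<open>On subsets of \<open>{1..n}\<close> this is the notion of a linear subclass of
  hyperplanes: two of the three hyperplanes on a flat of corank two force the third.\<close>

definition union_difference_closed :: "'a set set \<Rightarrow> bool" where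
  "union_difference_closed \<S> \<longleftrightarrow> {} \<notin> \<S> \<and> (\<forall>A\<in>\<S>. finite A) \<and>
     (\<forall>A\<in>\<S>. \<forall>B\<in>\<S>. A \<inter> B = {} \<longrightarrow> A \<union> B \<in> \<S>) \<and>
     (\<forall>A\<in>\<S>. \<forall>B\<in>\<S>. A \<subset> B \<longrightarrow> B - A \<in> \<S>)"

definition minimal_members :: "'a set set \<Rightarrow> 'a set set" where
  "minimal_members \<S> = {A \<in> \<S>. \<forall>B\<in>\<S>. \<not> B \<subset> A}"

text \<open>A member that is not minimal is the disjoint union of two smaller members, so the
  minimal ones generate the family.\<close>

lemma union_difference_closed_subset:
  assumes S: "union_difference_closed \<S>" and T: "union_difference_closed \<T>"
    and min: "minimal_members \<S> = minimal_members \<T>"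
  shows "\<S> \<subseteq> \<T>"
proof
  fix A assume "A \<in> \<S>"
  moreover from this have "finite A" using S by (simp add: union_difference_closed_def)
  ultimately show "A \<in> \<T>"
  proof (induction "card A" arbitrary: A rule: less_induct)
    case less
    show ?case
    proof (cases "A \<in> minimal_members \<S>")
      case True
      then have "A \<in> minimal_members \<T>" using min by simp
      then show ?thesis by (simp add: minimal_members_def)
    next
      case False
      then obtain B where B: "B \<in> \<S>" "B \<subset> A" using less.prems(1) by (auto simp: minimal_members_def)
      have D: "A - B \<in> \<S>" using S B less.prems(1) by (simp add: union_difference_closed_def)
      have "B \<noteq> {}" using S B(1) by (auto simp: union_difference_closed_def)
      then have "A - B \<subset> A" using B(2) by blast
      then have "card B < card A" "card (A - B) < card A"
        using B(2) less.prems(2) by (auto intro: psubset_card_mono)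
      moreover have "finite B" using B(2) less.prems(2) finite_subset by blast
      ultimately have "B \<in> \<T>" "A - B \<in> \<T>"
        using less.hyps[of B] less.hyps[of "A - B"] B(1) D less.prems(2) by auto
      moreover have "B \<inter> (A - B) = {}" "B \<union> (A - B) = A" using B(2) by blast+
      ultimately show ?thesis using T unfolding union_difference_closed_def by metis
    qed
  qed
qed

lemma union_difference_closed_eqI:
  assumes "union_difference_closed \<S>" "union_difference_closed \<T>" "minimal_members \<S> = minimal_members \<T>"
  shows "\<S> = \<T>"
  using assms union_difference_closed_subset[of \<S> \<T>] union_difference_closed_subset[of \<T> \<S>] by simp

locale complete_graphic_extension =
  fixes n :: nat and e :: "nat set" and N :: "nat set set_system"
  assumes e_new: "e \<notin> complete_graph_edges (n + 1)"
    and extension: "N \<in> extensions (cycle_matroid (complete_graph_edges (n + 1))) e"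
begin

lemma ground_N: "ground N = insert e (complete_graph_edges (n + 1))"
  using extension by (simp add: extensions_def cycle_matroid_def)

lemma matroid_N: "matroid N"
  using extension by (simp add: extensions_def is_extension_def)

text \<open>The definition deletes some element; comparing ground sets shows that it is
  \<open>e\<close>.\<close>

lemma deletion_N:
  shows "\<not> coloop N e" "deletion N e = cycle_matroid (complete_graph_edges (n + 1))"
proof -
  obtain x where x: "x \<in> ground N" "\<not> coloop N x"
      "deletion N x = cycle_matroid (complete_graph_edges (n + 1))"
    using extension unfolding extensions_def is_extension_def by blast
  have "ground N - {x} = complete_graph_edges (n + 1)"
    using arg_cong[OF x(3), of ground] by (simp add: deletion_def cycle_matroid_def)
  then have "x = e" using x(1) e_new ground_N by blast
  then show "\<not> coloop N e" "deletion N e = cycle_matroid (complete_graph_edges (n + 1))"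
    using x by simp_all
qed

lemma indep_iff_forest: "e \<notin> X \<Longrightarrow> X \<in> indep N \<longleftrightarrow> X \<in> forests n"
  using arg_cong[OF deletion_N(2), of indep] by (auto simp: deletion_def forests_def)

lemma e_notin_forest: "I \<in> forests n \<Longrightarrow> e \<notin> I"
  using new_notin_forest[OF e_new] .

lemma forest_indep: "I \<in> forests n \<Longrightarrow> I \<in> indep N"
  using indep_iff_forest e_notin_forest by blast

lemma card_insert_e: "I \<in> forests n \<Longrightarrow> card (insert e I) = Suc (card I)"
  using e_notin_forest finite_forest by simp

lemma indep_subset: "Y \<in> indep N \<Longrightarrow> X \<subseteq> Y \<Longrightarrow> X \<in> indep N"
  using matroid_N unfolding matroid_def by blast

lemma indep_augment:
  assumes "X \<in> indep N" "Y \<in> indep N" "card X < card Y"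
  obtains y where "y \<in> Y" "y \<notin> X" "insert y X \<in> indep N"
  using assms matroid_N unfolding matroid_def by (metis DiffE)

text \<open>Since \<open>e\<close> is not a coloop, some basis avoids it. That basis is a forest
  with at most \<open>n\<close> edges, so no independent set is larger than
  \<open>n\<close>.\<close>

lemma insert_e_full_forest_dependent:
  assumes J: "J \<in> forests n" "card J = n"
  shows "insert e J \<notin> indep N"
proof
  assume ind: "insert e J \<in> indep N"
  have "e \<in> ground N" using ground_N by simp
  then obtain B where B: "basis N B" "e \<notin> B" using deletion_N(1) by (auto simp: coloop_def)
  then have BN: "B \<in> indep N" and Bf: "B \<in> forests n"
    using indep_iff_forest by (auto simp: basis_def)
  have "card B < card (insert e J)"
    using card_forest_le[OF Bf] card_insert_e[OF J(1)] J(2) by simp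
  with BN ind obtain y where y: "y \<notin> B" "insert y B \<in> indep N" by (rule indep_augment)
  then have "insert y B = B" using B(1) unfolding basis_def by blast
  then show False using y(1) by blast
qed

text \<open>Whether \<open>e\<close> can be added depends only on the closure. Augmenting
  \<open>K\<close> from \<open>insert e J\<close> without \<open>e\<close> would add an edge of
  \<open>J\<close>, but such an edge crosses no cut of \<open>K\<close>.\<close>

lemma insert_e_indep_cong:
  assumes J: "J \<in> forests n" "insert e J \<in> indep N" and K: "K \<in> forests n" "cuts n K = cuts n J"
  shows "insert e K \<in> indep N"
proof (rule ccontr)
  assume contra: "insert e K \<notin> indep N"
  have "(2::nat) ^ (n - card K) = 2 ^ (n - card J)"
    using K(2) card_cuts_forest[OF K(1)] card_cuts_forest[OF J(1)] by simp
  then have "card K = card J"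
    using card_forest_le[OF K(1)] card_forest_le[OF J(1)] by simp
  then have "card K < card (insert e J)" using card_insert_e[OF J(1)] by simp
  with forest_indep[OF K(1)] J(2) obtain y
    where y: "y \<in> insert e J" "y \<notin> K" "insert y K \<in> indep N" by (rule indep_augment)
  then have "y \<noteq> e" using contra by blast
  then have yJ: "y \<in> J" and yK: "insert y K \<in> forests n"
    using y indep_iff_forest[of "insert y K"] e_notin_forest[OF K(1)] by auto
  have "cuts n (insert y K) = cuts n K" using yJ unfolding cuts_insert K(2) by (auto simp: cuts_def)
  then show False
    using card_cuts_insert_forest[OF K(1) yK y(2)] card_cuts_pos[of n K] by simp
qed

text \<open>The hyperplanes whose closure in \<open>N\<close> contains \<open>e\<close>.\<close>

definition spanning_cuts :: "nat set set" where
  "spanning_cuts = {A. A \<noteq> {} \<and> (\<exists>J\<in>forests n. cuts n J = {{}, A} \<and> insert e J \<notin> indep N)}"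

lemma spanning_cuts_iff:
  assumes "J \<in> forests n" "cuts n J = {{}, A}" "A \<noteq> {}"
  shows "A \<in> spanning_cuts \<longleftrightarrow> insert e J \<notin> indep N"
proof
  assume "A \<in> spanning_cuts"
  then obtain K where "K \<in> forests n" "cuts n K = {{}, A}" "insert e K \<notin> indep N"
    unfolding spanning_cuts_def by blast
  then show "insert e J \<notin> indep N" using insert_e_indep_cong[of J K] assms(1,2) by auto
next
  assume "insert e J \<notin> indep N"
  then show "A \<in> spanning_cuts" using assms unfolding spanning_cuts_def by blast
qed

lemma spanning_cuts_subset: "spanning_cuts \<subseteq> Pow {1..n} - {{}}"
proof
  fix A assume "A \<in> spanning_cuts"
  then obtain J where J: "A \<noteq> {}" "cuts n J = {{}, A}" by (auto simp: spanning_cuts_def)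
  then have "A \<in> cuts n J" by simp
  with J(1) show "A \<in> Pow {1..n} - {{}}" by (simp add: cuts_def)
qed

text \<open>Edges are added, keeping independence together with \<open>e\<close>, until the forest
  has \<open>n - 1\<close> of them. It then has a single nonempty cut, which is not spanning and is
  also a cut of \<open>I\<close>.\<close>

lemma insert_e_indep_imp_cut:
  assumes "I \<in> forests n" "insert e I \<in> indep N"
  shows "\<exists>A\<in>cuts n I. A \<noteq> {} \<and> A \<notin> spanning_cuts"
  using assms
proof (induction "n - card I" arbitrary: I rule: less_induct)
  case less
  have "card I \<noteq> n" using insert_e_full_forest_dependent less.prems by blast
  then have lt: "card I < n" using card_forest_le[OF less.prems(1)] by simp
  show ?case
  proof (cases "Suc (card I) = n")
    case True
    obtain A where A: "A \<in> cuts n I" "A \<noteq> {}"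
      using less.prems(1) lt by (rule ex_nonempty_cut)
    have "n - card I = 1" using True by linarith
    then have "card (cuts n I) = card {{}, A}" using card_cuts_forest[OF less.prems(1)] A(2) by simp
    moreover have "{{}, A} \<subseteq> cuts n I" using A(1) by simp
    ultimately have "cuts n I = {{}, A}" by (metis card_subset_eq finite_cuts)
    then have "A \<notin> spanning_cuts" using spanning_cuts_iff less.prems A(2) by blast
    then show ?thesis using A by blast
  next
    case False
    obtain B where B: "B \<in> forests n" "card B = n" by (rule ex_full_forest)
    have "card (insert e I) < card B" using False lt B(2) card_insert_e[OF less.prems(1)] by simp
    with less.prems(2) forest_indep[OF B(1)] obtain y
      where y: "y \<in> B" "y \<notin> insert e I" "insert y (insert e I) \<in> indep N" by (rule indep_augment)
    have "insert y I \<in> indep N" using y(3) by (rule indep_subset) blast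
    then have yI: "insert y I \<in> forests n"
      using indep_iff_forest[of "insert y I"] y(2) e_notin_forest[OF less.prems(1)] by blast
    have "card (insert y I) = Suc (card I)" using y(2) finite_forest[OF less.prems(1)] by simp
    then have "n - card (insert y I) < n - card I" using lt by simp
    moreover have "insert e (insert y I) \<in> indep N" using y(3) by (simp add: insert_commute)
    ultimately have "\<exists>A\<in>cuts n (insert y I). A \<noteq> {} \<and> A \<notin> spanning_cuts" using less.hyps yI by blast
    then show ?thesis using cuts_antimono[of I "insert y I" n] by blast
  qed
qed

lemma cut_imp_insert_e_indep:
  assumes I: "I \<in> forests n" and A: "A \<in> cuts n I" "A \<noteq> {}" "A \<notin> spanning_cuts"
  shows "insert e I \<in> indep N"
proof -
  obtain J where J: "J \<in> forests n" "I \<subseteq> J" "cuts n J = {{}, A}"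
    using I A(1) by (rule forest_with_part)
  then have "insert e J \<in> indep N" using spanning_cuts_iff A(2,3) by blast
  then show ?thesis by (rule indep_subset) (use J(2) in blast)
qed

lemma eq_cut_extension: "N = cut_extension n e spanning_cuts"
proof -
  have "indep N = indep (cut_extension n e spanning_cuts)"
  proof (rule set_eqI)
    fix X
    show "X \<in> indep N \<longleftrightarrow> X \<in> indep (cut_extension n e spanning_cuts)"
    proof (cases "e \<in> X")
      case True
      define I where "I = X - {e}"
      have X: "X = insert e I" "e \<notin> I" using True by (auto simp: I_def)
      have "I \<in> forests n" if "X \<in> indep N"
        using indep_subset[OF that, of I] indep_iff_forest X by blast
      then have "X \<in> indep N \<longleftrightarrow> I \<in> forests n \<and> (\<exists>A\<in>cuts n I. A \<noteq> {} \<and> A \<notin> spanning_cuts)"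
        using insert_e_indep_imp_cut[of I] cut_imp_insert_e_indep[of I] X(1) by auto
      then show ?thesis
        using insert_in_cut_extension[OF e_new X(2), of spanning_cuts] X(1) by simp
    next
      case False
      then show ?thesis using indep_iff_forest by (auto simp: cut_extension_def)
    qed
  qed
  then show ?thesis using ground_N by (simp add: cut_extension_def)
qed

text \<open>If \<open>e\<close> is in the closures of the hyperplanes \<open>A\<close> and
  \<open>B\<close>, it is in the closure of \<open>I\<close>: otherwise \<open>f\<close> or
  \<open>g\<close> would augment \<open>insert e I\<close>. Hence it is in the closure of
  \<open>C\<close>. Keeping the edges as hypotheses allows the three hyperplanes to be permuted,
  which yields both unions and differences.\<close>

lemma third_spanning_cut:
  assumes I: "I \<in> forests n" and cuts: "cuts n I = {{}, A, B, C}"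
    and nonempty: "A \<noteq> {}" "B \<noteq> {}" "C \<noteq> {}" and distinct: "A \<noteq> B" "A \<noteq> C" "B \<noteq> C"
    and edges: "f \<in> complete_graph_edges (n + 1)" "cuts n (insert f I) = {{}, A}"
      "g \<in> complete_graph_edges (n + 1)" "cuts n (insert g I) = {{}, B}"
      "h \<in> complete_graph_edges (n + 1)" "cuts n (insert h I) = {{}, C}"
    and AB: "A \<in> spanning_cuts" "B \<in> spanning_cuts"
  shows "C \<in> spanning_cuts"
proof -
  have add: "insert x F \<in> forests n" "x \<notin> F"
    if "F \<in> forests n" "x \<in> complete_graph_edges (n + 1)" "D \<in> cuts n F" "D \<notin> cuts n (insert x F)" for x F D
    using insert_forest[OF that(1,2,3)] that(3,4) by (auto simp: cuts_insert)
  have f: "insert f I \<in> forests n" "f \<notin> I"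
    using add[OF I edges(1), of B] cuts edges(2) nonempty distinct by auto
  have g: "insert g I \<in> forests n" "g \<notin> I"
    using add[OF I edges(3), of A] cuts edges(4) nonempty distinct by auto
  have h: "insert h I \<in> forests n"
    using add(1)[OF I edges(5), of A] cuts edges(6) nonempty distinct by auto
  have "A \<notin> cuts n (insert g (insert f I))"
  proof
    assume "A \<in> cuts n (insert g (insert f I))"
    then have "A \<in> cuts n (insert g I)" by (simp add: cuts_insert)
    then show False using edges(4) nonempty distinct by simp
  qed
  then have gf: "insert g (insert f I) \<in> forests n" "g \<notin> insert f I"
    using add[OF f(1) edges(3), of A] edges(2) by auto
  have dep: "insert e (insert f I) \<notin> indep N" "insert e (insert g I) \<notin> indep N"
    using spanning_cuts_iff[OF f(1) edges(2) nonempty(1)] spanning_cuts_iff[OF g(1) edges(4) nonempty(2)] AB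
    by blast+
  have "insert e I \<notin> indep N"
  proof
    assume ind: "insert e I \<in> indep N"
    have "card (insert e I) < card (insert g (insert f I))"
      using card_insert_e[OF I] gf(2) f(2) finite_forest[OF I] by simp
    with ind forest_indep[OF gf(1)] obtain y
      where y: "y \<in> insert g (insert f I)" "y \<notin> insert e I" "insert y (insert e I) \<in> indep N"
      by (rule indep_augment)
    then have "y = g \<or> y = f" by blast
    then show False using y(3) dep by (auto simp: insert_commute)
  qed
  then have "insert e (insert h I) \<notin> indep N"
    using indep_subset[of "insert e (insert h I)" "insert e I"] by auto
  then show ?thesis using spanning_cuts_iff[OF h edges(6) nonempty(3)] by blast
qed

lemma spanning_cuts_disjoint:
  assumes A: "A \<subseteq> {1..n}" "A \<noteq> {}" and B: "B \<subseteq> {1..n}" "B \<noteq> {}" and disj: "A \<inter> B = {}"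
  shows "A \<in> spanning_cuts \<Longrightarrow> B \<in> spanning_cuts \<Longrightarrow> A \<union> B \<in> spanning_cuts"
    and "A \<in> spanning_cuts \<Longrightarrow> A \<union> B \<in> spanning_cuts \<Longrightarrow> B \<in> spanning_cuts"
proof -
  let ?E = "complete_graph_edges (n + 1)"
  have "A \<in> cuts n {}" "B \<in> cuts n {}" using A B by (auto simp: cuts_def)
  with A(1) B(1) disj empty_forest obtain I
    where I: "I \<in> forests n" "{} \<subseteq> I" "cuts n I = {{}, A, B, A \<union> B}" by (rule forest_with_two_parts)
  obtain a b where ab: "a \<in> A" "b \<in> B" using A(2) B(2) by blast
  have n1: "n + 1 \<notin> A" "n + 1 \<notin> B" using A B by auto
  have ab': "a \<notin> B" "b \<notin> A" "a \<in> {1..n}" "b \<in> {1..n}" using ab disj A B by auto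
  \<comment> \<open>The vertex classes are \<open>A\<close>, \<open>B\<close> and the rest, which
    contains \<open>n + 1\<close>. Each of these edges merges two classes and leaves only the cut
    that does not separate them.\<close>
  define f where "f = {b, n + 1}"
  define g where "g = {a, n + 1}"
  define h where "h = {a, b}"
  have E: "f \<in> ?E" "g \<in> ?E" "h \<in> ?E"
    unfolding f_def g_def h_def using ab ab' by (auto intro!: edgeI)
  have c: "cuts n (insert f I) = {{}, A}" "cuts n (insert g I) = {{}, B}"
    "cuts n (insert h I) = {{}, A \<union> B}"
    unfolding cuts_insert I(3) f_def g_def h_def using ab ab' n1 by auto
  have d: "A \<noteq> B" "A \<noteq> A \<union> B" "B \<noteq> A \<union> B" "A \<union> B \<noteq> {}" using ab ab' by blast+
  show "A \<union> B \<in> spanning_cuts" if "A \<in> spanning_cuts" "B \<in> spanning_cuts"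
    by (rule third_spanning_cut[OF I(1,3) A(2) B(2) d(4,1,2,3) E(1) c(1) E(2) c(2) E(3) c(3) that])
  have I': "cuts n I = {{}, A, A \<union> B, B}" using I(3) by (simp add: insert_commute)
  show "B \<in> spanning_cuts" if "A \<in> spanning_cuts" "A \<union> B \<in> spanning_cuts"
    by (rule third_spanning_cut[OF I(1) I' A(2) d(4) B(2) d(2,1) d(3)[symmetric] E(1) c(1) E(3) c(3) E(2) c(2) that])
qed

lemma union_difference_closed_spanning_cuts: "union_difference_closed spanning_cuts"
  unfolding union_difference_closed_def
proof (intro conjI ballI impI)
  show "{} \<notin> spanning_cuts" using spanning_cuts_subset by blast
  show "finite A" if "A \<in> spanning_cuts" for A
    using that spanning_cuts_subset finite_subset[of A "{1..n}"] by auto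
  show "A \<union> B \<in> spanning_cuts" if "A \<in> spanning_cuts" "B \<in> spanning_cuts" "A \<inter> B = {}" for A B
    using spanning_cuts_disjoint(1)[of A B] that spanning_cuts_subset by blast
  show "B - A \<in> spanning_cuts" if "A \<in> spanning_cuts" "B \<in> spanning_cuts" "A \<subset> B" for A B
  proof -
    have "A \<union> (B - A) = B" "B - A \<noteq> {}" using that(3) by blast+
    moreover have "A \<subseteq> {1..n}" "A \<noteq> {}" "B \<subseteq> {1..n}" using that(1,2) spanning_cuts_subset by blast+
    ultimately show ?thesis using spanning_cuts_disjoint(2)[of A "B - A"] that(1,2) by auto
  qed
qed

end

section \<open>Combinatorial bounds on the number of extensions\<close>

lemma card_extensions_le_card_antichains:
  assumes "e \<notin> complete_graph_edges (n + 1)"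
  shows "card (extensions (cycle_matroid (complete_graph_edges (n + 1))) e)
    \<le> card {\<A>. \<A> \<subseteq> Pow {1..n} - {{}} \<and> (\<forall>A\<in>\<A>. \<forall>B\<in>\<A>. \<not> (A \<subset> B \<or> B \<subset> A))}"
proof (rule card_inj_on_le)
  let ?X = "extensions (cycle_matroid (complete_graph_edges (n + 1))) e"
  let ?s = "complete_graphic_extension.spanning_cuts n e"
  have loc: "complete_graphic_extension n e N" if "N \<in> ?X" for N
    using assms that by (rule complete_graphic_extension.intro)
  show "inj_on (\<lambda>N. minimal_members (?s N)) ?X"
  proof (rule inj_onI)
    fix N N' assume N: "N \<in> ?X" "N' \<in> ?X" and eq: "minimal_members (?s N) = minimal_members (?s N')"
    have "?s N = ?s N'"
      using complete_graphic_extension.union_difference_closed_spanning_cuts[OF loc[OF N(1)]]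
        complete_graphic_extension.union_difference_closed_spanning_cuts[OF loc[OF N(2)]]
        eq
      by (rule union_difference_closed_eqI)
    then show "N = N'"
      using complete_graphic_extension.eq_cut_extension[OF loc[OF N(1)]]
        complete_graphic_extension.eq_cut_extension[OF loc[OF N(2)]] by simp
  qed
  show "(\<lambda>N. minimal_members (?s N)) ` ?X
      \<subseteq> {\<A>. \<A> \<subseteq> Pow {1..n} - {{}} \<and> (\<forall>A\<in>\<A>. \<forall>B\<in>\<A>. \<not> (A \<subset> B \<or> B \<subset> A))}"
  proof
    fix \<A> assume "\<A> \<in> (\<lambda>N. minimal_members (?s N)) ` ?X"
    then obtain N where N: "N \<in> ?X" "\<A> = minimal_members (?s N)" by blast
    have "?s N \<subseteq> Pow {1..n} - {{}}"
      using complete_graphic_extension.spanning_cuts_subset[OF loc[OF N(1)]] .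
    then show "\<A> \<in> {\<A>. \<A> \<subseteq> Pow {1..n} - {{}} \<and> (\<forall>A\<in>\<A>. \<forall>B\<in>\<A>. \<not> (A \<subset> B \<or> B \<subset> A))}"
      unfolding N(2) minimal_members_def by blast
  qed
  show "finite {\<A>. \<A> \<subseteq> Pow {1..n} - {{}} \<and> (\<forall>A\<in>\<A>. \<forall>B\<in>\<A>. \<not> (A \<subset> B \<or> B \<subset> A))}"
    by (rule finite_subset[of _ "Pow (Pow {1..n})"]) auto
qed

text \<open>Sets with more than half of the points meet pairwise, and sets of equal size form an
  antichain, so every family of \<open>k\<close>-subsets yields an extension.\<close>

lemma card_extensions_ge:
  assumes e: "e \<notin> complete_graph_edges (n + 1)" and k: "n < 2 * k"
  shows "2 ^ (n choose k) \<le> card (extensions (cycle_matroid (complete_graph_edges (n + 1))) e)"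
proof -
  let ?L = "{A. A \<subseteq> {1..n} \<and> card A = k}"
  have L: "?L \<subseteq> Pow {1..n} - {{}}" using k by auto
  have finL: "finite ?L" by (rule finite_subset[of _ "Pow {1..n}"]) auto
  have "2 ^ (n choose k) = card (Pow ?L)"
    using n_subsets[of "{1..n}" k] finL by (simp add: card_Pow)
  also have "\<dots> \<le> card (extensions (cycle_matroid (complete_graph_edges (n + 1))) e)"
  proof (rule card_inj_on_le)
    show "inj_on (cut_extension n e) (Pow ?L)"
      using inj_on_cut_extension[OF e] by (rule inj_on_subset) (use L in blast)
    show "finite (extensions (cycle_matroid (complete_graph_edges (n + 1))) e)"
      by (rule finite_extensions)
    show "cut_extension n e ` Pow ?L \<subseteq> extensions (cycle_matroid (complete_graph_edges (n + 1))) e"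
    proof
      fix M assume "M \<in> cut_extension n e ` Pow ?L"
      then obtain \<A> where \<A>: "\<A> \<subseteq> ?L" "M = cut_extension n e \<A>" by blast
      have "A \<inter> B \<noteq> {}" if "A \<in> \<A>" "B \<in> \<A>" for A B
      proof
        assume disj: "A \<inter> B = {}"
        have AB: "A \<subseteq> {1..n}" "B \<subseteq> {1..n}" "card A = k" "card B = k" using that \<A>(1) by auto
        then have "finite A" "finite B" by (auto intro: finite_subset)
        then have "2 * k = card (A \<union> B)" using card_Un_disjoint disj AB(3,4) by fastforce
        also have "\<dots> \<le> card {1..n}" using AB(1,2) by (intro card_mono) auto
        finally show False using k by simp
      qed
      moreover have "A = B" if "A \<in> \<A>" "B \<in> \<A>" "A \<subseteq> B" for A B
      proof -
        have "B \<subseteq> {1..n}" "card A = card B" using that \<A>(1) by auto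
        then show ?thesis using that(3) by (meson card_subset_eq finite_atLeastAtMost finite_subset)
      qed
      ultimately show "M \<in> extensions (cycle_matroid (complete_graph_edges (n + 1))) e"
        unfolding \<A>(2) using e by (intro cut_extension_in_extensions)
    qed
  qed
  finally show ?thesis .
qed

section \<open>Asymptotics\<close>

text \<open>The first summand comes from the at most \<open>m\<close> sets left when no further
  branching is guaranteed, the second from a factor 1 + \<epsilon> for each of at most 2^n sets,
  measured in units of the middle binomial.\<close>

lemma card_extensions_le:
  assumes e: "e \<notin> complete_graph_edges (n + 1)" and d: "2 * d < n"
    and \<epsilon>: "0 \<le> \<epsilon>" "1 \<le> \<epsilon> * (1 + \<epsilon>) ^ Suc d"
  shows "log 2 (real (card (extensions (cycle_matroid (complete_graph_edges (n + 1))) e)))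
    \<le> real (n choose (n div 2)) * (1 / (1 - 2 * real d / real n) + 2 * sqrt (real n) * log 2 (1 + \<epsilon>))"
proof -
  let ?N = "real (n choose (n div 2))" and ?c = "1 - 2 * real d / real n"
  let ?x = "card (extensions (cycle_matroid (complete_graph_edges (n + 1))) e)"
  define V where "V = Pow {1..n} - {{}}"
  define m where "m = nat \<lfloor>?N / ?c\<rfloor>"
  have n: "n > 0" and c: "?c > 0" using d by (auto simp: field_simps)
  have finV: "finite V" by (simp add: V_def)
  have "\<exists>A\<in>B. Suc d \<le> card {C\<in>B. A \<subset> C \<or> C \<subset> A}" if B: "B \<subseteq> V" "m < card B" for B
  proof (rule ccontr)
    assume "\<not> ?thesis"
    then have "?c * real (card B) \<le> ?N"
      using B(1) n by (intro card_le_of_bounded_comparability) (auto simp: V_def not_less_eq_eq)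
    then have "real (card B) \<le> ?N / ?c" using c by (simp add: field_simps)
    then have "card B \<le> m" unfolding m_def by linarith
    then show False using B(2) by simp
  qed
  then have "real (card {\<A>. \<A> \<subseteq> V \<and> (\<forall>A\<in>\<A>. \<forall>B\<in>\<A>. \<not> (A \<subset> B \<or> B \<subset> A))}) \<le> 2 ^ m * (1 + \<epsilon>) ^ card V"
    using \<epsilon> finV by (intro card_independent_sets_le[where d = "Suc d"]) auto
  moreover have "card V \<le> 2 ^ n"
    using card_mono[of "Pow {1..n}" V] by (auto simp: V_def card_Pow)
  then have "2 ^ m * (1 + \<epsilon>) ^ card V \<le> 2 ^ m * (1 + \<epsilon>) ^ (2 ^ n)"
    using \<epsilon>(1) by (intro mult_left_mono power_increasing) auto
  ultimately have le: "real ?x \<le> 2 ^ m * (1 + \<epsilon>) ^ (2 ^ n)"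
    using card_extensions_le_card_antichains[OF e] unfolding V_def by linarith
  \<comment> \<open>The logarithm is monotone only from a positive count on; the layer
    \<open>k = n\<close> provides this.\<close>
  have "0 < (2::nat) ^ (n choose n)" by simp
  also have "\<dots> \<le> ?x" using n by (intro card_extensions_ge[OF e]) simp
  finally have "log 2 (real ?x) \<le> log 2 (2 ^ m * (1 + \<epsilon>) ^ (2 ^ n))"
    using le by (intro log_mono) auto
  also have "\<dots> = real m + 2 ^ n * log 2 (1 + \<epsilon>)"
    using \<epsilon>(1) by (simp add: log_mult log_nat_power)
  also have "\<dots> \<le> ?N / ?c + (2 * sqrt (real n) * ?N) * log 2 (1 + \<epsilon>)"
  proof (intro add_mono mult_right_mono)
    show "real m \<le> ?N / ?c" using c unfolding m_def by simp
    show "2 ^ n \<le> 2 * sqrt (real n) * ?N" by (rule two_power_le_sqrt_mult_middle_binomial[OF n])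
  qed (use \<epsilon>(1) in simp)
  finally show ?thesis by (simp add: algebra_simps)
qed

text \<open>With k = n div 2, consecutive binomials have ratio (n - k) / (k + 1), which is at least
  k / (k + 1).\<close>

lemma binomial_above_middle_ge:
  assumes "n \<ge> 1"
  shows "real (n choose (n div 2)) * (1 - 2 / real n) \<le> real (n choose Suc (n div 2))"
proof -
  let ?k = "n div 2"
  have "(n choose Suc ?k) * Suc ?k = (n choose ?k) * (n - ?k)"
    using binomial_absorption[of ?k n] binomial_absorb_comp[of n ?k] by (simp add: mult.commute)
  then have eq: "real (n choose Suc ?k) * real (Suc ?k) = real (n choose ?k) * real (n - ?k)"
    by (metis of_nat_mult)
  have "1 - 2 / real n \<le> real (n - ?k) / real (Suc ?k)"
  proof -
    have "n \<le> 2 * Suc ?k" by presburger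
    then have "1 - 2 / real n \<le> 1 - 1 / real (Suc ?k)"
      using assms by (simp add: field_simps)
    also have "\<dots> = real ?k / real (Suc ?k)" by (simp add: field_simps)
    also have "\<dots> \<le> real (n - ?k) / real (Suc ?k)"
      by (intro divide_right_mono) linarith+
    finally show ?thesis .
  qed
  then have "real (n choose ?k) * (1 - 2 / real n) \<le> real (n choose ?k) * (real (n - ?k) / real (Suc ?k))"
    by (intro mult_left_mono) auto
  also have "\<dots> = real (n choose Suc ?k)"
    using eq by (simp add: field_simps)
  finally show ?thesis .
qed

theorem theorem1p1:
  fixes e :: "nat \<Rightarrow> nat set"
  assumes "\<And>n. n \<ge> 1 \<Longrightarrow> e n \<notin> complete_graph_edges (n + 1)"
  shows "\<exists>f :: nat \<Rightarrow> real. f \<longlonglongrightarrow> 0 \<and>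
    (\<forall>n\<ge>1. real (card (extensions (cycle_matroid (complete_graph_edges (n + 1))) (e n)))
       = 2 powr (real (n choose (n div 2)) * (1 + f n)))"
proof -
  define x where "x = (\<lambda>n. real (card (extensions (cycle_matroid (complete_graph_edges (n + 1))) (e n))))"
  define N where "N = (\<lambda>n. real (n choose (n div 2)))"
  \<comment> \<open>This solves the required equation for the error term; what remains is its
    limit.\<close>
  define f where "f = (\<lambda>n. log 2 (x n) / N n - 1)"
  have N: "N n > 0" for n by (simp add: N_def)
  have x_ge: "2 ^ (n choose Suc (n div 2)) \<le> x n" if "n \<ge> 1" for n
  proof -
    have "n < 2 * Suc (n div 2)" by presburger
    then have "real (2 ^ (n choose Suc (n div 2))) \<le> x n"
      unfolding x_def using card_extensions_ge[OF assms[OF that]] by (simp only: of_nat_le_iff)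
    then show ?thesis by simp
  qed
  have x_pos: "x n > 0" if "n \<ge> 1" for n
    by (rule less_le_trans[OF _ x_ge[OF that]]) simp
  have lower: "\<forall>\<^sub>F n in sequentially. - 2 / real n \<le> f n"
    using eventually_ge_at_top[of 1]
  proof eventually_elim
    case (elim n)
    have "N n * (1 - 2 / real n) \<le> real (n choose Suc (n div 2))"
      unfolding N_def using elim by (rule binomial_above_middle_ge)
    also have "\<dots> = log 2 (2 ^ (n choose Suc (n div 2)))" by (simp add: log_nat_power)
    also have "\<dots> \<le> log 2 (x n)" using x_ge[OF elim] by (intro log_mono) auto
    finally have "1 - 2 / real n \<le> log 2 (x n) / N n" using N[of n] by (simp add: field_simps)
    then show ?case by (simp add: f_def)
  qed
  \<comment> \<open>The choice is d about n^(4/5) and \<epsilon> = n^(-3/5). Then d/n is about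
    n^(-1/5) and \<epsilon> sqrt n = n^(-1/10), both vanishing, while (1 + \<epsilon>)^d grows like
    exp (n^(1/5)) and outweighs 1/\<epsilon>.\<close>
  define u where "u = (\<lambda>n :: nat. 1 / (1 - 2 * real n powr (- 1 / 5))
    + 2 * sqrt (real n) * log 2 (1 + real n powr (- 3 / 5)) - 1)"
  have "\<forall>\<^sub>F n :: nat in sequentially. 1 \<le> real n powr (- 3 / 5) * (1 + real n powr (- 3 / 5)) powr (real n powr (4 / 5))"
    by real_asymp
  moreover have "\<forall>\<^sub>F n :: nat in sequentially. 2 * real n powr (4 / 5) < real n"
    by real_asymp
  ultimately have upper: "\<forall>\<^sub>F n in sequentially. f n \<le> u n"
    using eventually_ge_at_top[of 1]
  proof eventually_elim
    case (elim n)
    \<comment> \<open>Rounding down is harmless: \<open>card_extensions_le\<close> has the exponent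
      \<open>Suc d\<close>, which is at least n^(4/5).\<close>
    define d where "d = nat \<lfloor>real n powr (4 / 5)\<rfloor>"
    define \<epsilon> where "\<epsilon> = real n powr (- 3 / 5)"
    have d: "real d \<le> real n powr (4 / 5)" "real n powr (4 / 5) \<le> real (Suc d)"
      unfolding d_def using powr_ge_zero[of "real n" "4 / 5"] by linarith+
    have \<epsilon>: "0 \<le> \<epsilon>" by (simp add: \<epsilon>_def)
    have "1 \<le> \<epsilon> * (1 + \<epsilon>) powr (real n powr (4 / 5))" using elim(1) by (simp add: \<epsilon>_def)
    also have "\<dots> \<le> \<epsilon> * (1 + \<epsilon>) powr real (Suc d)"
      using d(2) \<epsilon> by (intro mult_left_mono powr_mono) auto
    also have "\<dots> = \<epsilon> * (1 + \<epsilon>) ^ Suc d" using \<epsilon> by (subst powr_realpow) auto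
    finally have "log 2 (x n) \<le> N n * (1 / (1 - 2 * real d / real n) + 2 * sqrt (real n) * log 2 (1 + \<epsilon>))"
      unfolding x_def N_def using elim(2) d(1) \<epsilon> assms[OF elim(3)] by (intro card_extensions_le) linarith+
    then have "f n \<le> 1 / (1 - 2 * real d / real n) + 2 * sqrt (real n) * log 2 (1 + \<epsilon>) - 1"
      using N[of n] by (simp add: f_def divide_le_eq mult.commute)
    moreover have "1 / (1 - 2 * real d / real n) \<le> 1 / (1 - 2 * real n powr (- 1 / 5))"
    proof -
      have eq: "real n powr (- 1 / 5) = real n powr (4 / 5) / real n"
        using elim(3) powr_diff[of "real n" "4 / 5" 1] by simp
      have "2 * real d / real n \<le> 2 * real n powr (- 1 / 5)"
        unfolding eq using d(1) by (simp add: divide_right_mono)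
      moreover have "2 * real n powr (- 1 / 5) < 1" unfolding eq using elim(2,3) by simp
      ultimately show ?thesis by (intro divide_left_mono mult_pos_pos) linarith+
    qed
    ultimately show ?case unfolding u_def \<epsilon>_def by linarith
  qed
  have "(\<lambda>n :: nat. - 2 / real n) \<longlonglongrightarrow> 0" by real_asymp
  moreover have "u \<longlonglongrightarrow> 0" unfolding u_def by real_asymp
  ultimately have "f \<longlonglongrightarrow> 0" by (rule tendsto_sandwich[OF lower upper])
  moreover have "x n = 2 powr (N n * (1 + f n))" if "n \<ge> 1" for n
    using x_pos[OF that] N[of n] by (simp add: f_def)
  ultimately show ?thesis unfolding x_def N_def by blast
qed

end
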